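(* Let $R$ be an Archimedean Riesz space with weak unit $e$. Then the map $m\colon R\to\mathrm{C}(\mathcal{B}(R))$ into the Riesz space of continuous real functions on the frame $\mathcal{B}(R)$ of bands of $R$ is the universal completion of $R$; that is, $\mathrm{C}(\mathcal{B}(R))$ is universally complete, $m$ is a Riesz space embedding, and every $h\in\mathrm{C}(\mathcal{B}(R))^+$ satisfies $h=\bigvee\{m(f)\mid f\in R,\ \boldsymbol{0}\le m(f)\le h\}$.
   Context: An ideal of a Riesz space $R$ is a Riesz subspace $A$ such that $|g|\le|f|$, $f\in A$ imply $g\in A$. A band is an ideal $A$ such that whenever a subset of $A$ has a supremum in $R$, that supremum lies in $A$. For Archimedean $R$, the set $\mathcal{B}(R)$ of bands ordered by inclusion is a complete Boolean algebra (hence a frame), with meets given by intersection. $[f]$ is the band generated by $f$. A weak unit is an element $e>0$ with $[e]=R$ (equivalently, $e\wedge |f|=0$ implies $f=0$). The frame of reals $\mathfrak{L}(\mathbb{R})$ is the frame presented by generators $(p,-)$ and $(-,p)$, $p\in\mathbb{Q}$, with relations $(p,-)\wedge(-,q)=0$ if $p\ge q$; $(p,-)\vee(-,q)=1$ if $p<q$; $(p,-)=\bigvee_{q>p}(q,-)$; $(-,p)=\bigvee_{q<p}(-,q)$; $\bigvee_p(p,-)=1$; $\bigvee_p(-,p)=1$. For a frame $L$, $\mathrm{C}(L)$ is the set of frame homomorphisms $\mathfrak{L}(\mathbb{R})\to L$, ordered by $f\le g$ iff $f(p,-)\le g(p,-)$ for all $p\in\mathbb{Q}$. It is an Archimedean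 Riesz space with $(f\vee g)(p,-)=f(p,-)\vee g(p,-)$, $(f\wedge g)(p,-)=f(p,-)\wedge g(p,-)$, $(f+g)(p,-)=\bigvee_{r\in\mathbb{Q}}f(r,-)\wedge g(p-r,-)$, $(f+g)(-,q)=\bigvee_{s\in\mathbb{Q}}f(-,s)\wedge g(-,q-s)$, $(-f)(p,-)=f(-,-p)$, $(-f)(-,q)=f(-q,-)$, and for $\lambda>0$ $(\lambda f)(p,-)=\bigvee\{f(r,-)\mid r\in\mathbb{Q},\lambda r>p\}$, $(\lambda f)(-,q)=\bigvee\{f(-,s)\mid s\in\mathbb{Q},\lambda s<q\}$; its zero $\boldsymbol{0}$ satisfies $\boldsymbol{0}(p,-)=1$ if $p<0$ and $0$ otherwise. For $f\in R$, $m(f)\in\mathrm{C}(\mathcal{B}(R))$ is the function given by $m(f)(p,-)=\bigvee_{r>p}[(f-re)^+]$ and $m(f)(-,q)=\bigvee_{r<q}[(f-re)^+]^\ast$ for $p,q\in\mathbb{Q}$ ($r$ ranging over $\mathbb{Q}$), where $^\ast$ denotes complement in $\mathcal{B}(R)$. A Riesz space is universally complete if it is Dedekind complete (nonempty subsets bounded above have suprema) and laterally complete (every nonempty set of pairwise disjoint positive elements has a supremum). A universal completion of $R$ is a universally complete Riesz space $\mathcal{U}(R)$ with a Riesz space embedding $\mu\colon R\to\mathcal{U}(R)$ such that $f=\bigvee\{\mu(g)\mid g\in R,\ 0\le\mu(g)\le f\}$ for all $f\in\mathcal{U}(R)^+$. *)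

theory Defs
  imports Complex_Main "HOL-Library.FSet" "HOL-Library.Lattice_Algebras" "HOL-Library.Lub_Glb"
begin

section \<open>Frames\<close>

text \<open>The library class \<^class>\<open>complete_distrib_lattice\<close> demands complete distributivity, which
  fails for frames such as the bands of a Riesz space; only the following law is wanted.\<close>

class frame = complete_lattice +
  assumes inf_Sup_frame: "inf a (Sup A) = (SUP x\<in>A. inf a x)"

lemma inf_SUP_frame: "inf a (SUP i\<in>I. f i) = (SUP i\<in>I. inf a (f i))" for a :: "'l::frame"
  by (simp add: inf_Sup_frame image_image)

lemma SUP_inf_frame: "inf (SUP i\<in>I. f i) a = (SUP i\<in>I. inf (f i) a)" for a :: "'l::frame"
  by (simp add: inf_SUP_frame inf_commute)

lemma SUP_inf_SUP_frame:
  "inf (SUP i\<in>I. f i) (SUP j\<in>J. g j) = (SUP i\<in>I. SUP j\<in>J. inf (f i) (g j))"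
  for f g :: "_ \<Rightarrow> 'l::frame"
  by (simp only: SUP_inf_frame) (simp only: inf_SUP_frame)

lemma inf_sup_frame: "inf a (sup b c) = sup (inf a b) (inf a c)" for a :: "'l::frame"
  using inf_Sup_frame[of a "{b, c}"] by simp

lemma sup_inf_frame: "sup a (inf b c) = inf (sup a b) (sup a c)" for a :: "'l::frame"
proof -
  have "inf (sup a b) (sup a c) = sup (inf (sup a b) a) (inf (sup a b) c)"
    by (rule inf_sup_frame)
  also have "\<dots> = sup a (sup (inf a c) (inf b c))"
    by (simp add: inf_commute[of "sup a b"] inf_sup_frame inf_sup_absorb inf_commute)
  also have "\<dots> = sup a (inf b c)"
    by (simp add: sup_assoc[symmetric] sup_inf_absorb)
  finally show ?thesis by simp
qed

lemma frame_cover_sup: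
  fixes a :: "'l::frame"
  assumes "sup c d = top" "inf a c \<le> b" "inf a d \<le> b"
  shows "a \<le> b"
proof -
  have "a = inf a (sup c d)" by (simp add: assms)
  also have "\<dots> \<le> b" unfolding inf_sup_frame using assms by simp
  finally show ?thesis .
qed

lemma frame_cover_SUP:
  fixes a :: "'l::frame"
  assumes "(SUP i\<in>I. c i) = top" "\<And>i. i \<in> I \<Longrightarrow> inf a (c i) \<le> b"
  shows "a \<le> b"
proof -
  have "a = inf a (SUP i\<in>I. c i)" by (simp add: assms)
  also have "\<dots> \<le> b" unfolding inf_SUP_frame using assms by (auto intro: SUP_least)
  finally show ?thesis .
qed

definition frame_hom :: "('a::complete_lattice \<Rightarrow> 'b::complete_lattice) \<Rightarrow> bool" where
  "frame_hom f \<longleftrightarrow>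
     f top = top \<and> (\<forall>x y. f (inf x y) = inf (f x) (f y)) \<and> (\<forall>A. f (Sup A) = (SUP x\<in>A. f x))"


section \<open>Frames presented by generators and relations\<close>

text \<open>A set \<open>S\<close> of finite sets of generators stands for the formal expression
  \<open>\<Or>{\<And>F | F \<in> S}\<close>, and a pair \<open>(S, T)\<close> for the relation that equates the two expressions.
  In particular \<open>{{||}}\<close> denotes the top and \<open>{}\<close> the bottom.  The elements of the frame
  presented by \<open>E\<close> are the sets of finite meets of generators that are downward closed
  (a finite meet gets smaller when generators are added) and that respect the relations in
  \<open>E\<close> and all their consequences under taking the meet with some \<open>\<And>H\<close>.\<close>

type_synonym 'g expr = "'g fset set"

definition saturated :: "('g expr \<times> 'g expr) set \<Rightarrow> 'g expr \<Rightarrow> bool" where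
  "saturated E X \<longleftrightarrow>
     (\<forall>F\<in>X. \<forall>H. F |\<union>| H \<in> X) \<and>
     (\<forall>(S, T)\<in>E. \<forall>H. (\<forall>F\<in>S. F |\<union>| H \<in> X) \<longleftrightarrow> (\<forall>F\<in>T. F |\<union>| H \<in> X))"

definition interp :: "('g \<Rightarrow> 'l::complete_lattice) \<Rightarrow> 'g expr \<Rightarrow> 'l" where
  "interp \<phi> S = (SUP F\<in>S. INF g\<in>fset F. \<phi> g)"

definition satisfies :: "('g \<Rightarrow> 'l::complete_lattice) \<Rightarrow> ('g expr \<times> 'g expr) set \<Rightarrow> bool" where
  "satisfies \<phi> E \<longleftrightarrow> (\<forall>(S, T)\<in>E. interp \<phi> S = interp \<phi> T)"

lemma saturated_Inter: "(\<And>X. X \<in> \<X> \<Longrightarrow> saturated E X) \<Longrightarrow> saturated E (\<Inter>\<X>)"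
  unfolding saturated_def
proof (intro conjI ballI allI; clarify)
  fix S T H
  assume X: "\<And>X. X \<in> \<X> \<Longrightarrow> (\<forall>F\<in>X. \<forall>H. F |\<union>| H \<in> X) \<and>
     (\<forall>(S, T)\<in>E. \<forall>H. (\<forall>F\<in>S. F |\<union>| H \<in> X) \<longleftrightarrow> (\<forall>F\<in>T. F |\<union>| H \<in> X))" and E: "(S, T) \<in> E"
  have "(\<forall>F\<in>S. F |\<union>| H \<in> X) \<longleftrightarrow> (\<forall>F\<in>T. F |\<union>| H \<in> X)" if "X \<in> \<X>" for X
    using X[OF that] E by blast
  then show "(\<forall>F\<in>S. F |\<union>| H \<in> \<Inter>\<X>) \<longleftrightarrow> (\<forall>F\<in>T. F |\<union>| H \<in> \<Inter>\<X>)"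
    unfolding Inter_iff by blast
qed blast

lemma saturated_UNIV: "saturated E UNIV"
  by (auto simp: saturated_def)

lemma saturated_imp:
  assumes "saturated E Y"
  shows "saturated E {F. \<forall>G\<in>X. F |\<union>| G \<in> Y}"
proof -
  have up: "F |\<union>| H \<in> Y" if "F \<in> Y" for F H
    using assms that by (auto simp: saturated_def)
  have rel: "(\<forall>F\<in>S. F |\<union>| H \<in> Y) \<longleftrightarrow> (\<forall>F\<in>T. F |\<union>| H \<in> Y)" if "(S, T) \<in> E" for S T H
    using assms that by (fastforce simp: saturated_def)
  show ?thesis
    unfolding saturated_def
  proof (intro conjI ballI allI; clarsimp)
    fix F H G assume "\<forall>G\<in>X. F |\<union>| G \<in> Y" "G \<in> X"
    then have "(F |\<union>| G) |\<union>| H \<in> Y" using up by blast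
    then show "F |\<union>| H |\<union>| G \<in> Y" by (simp add: funion_assoc funion_commute[of G H])
  next
    fix S T H assume "(S, T) \<in> E"
    note r = rel[OF this]
    show "(\<forall>F\<in>S. \<forall>G\<in>X. F |\<union>| H |\<union>| G \<in> Y) = (\<forall>F\<in>T. \<forall>G\<in>X. F |\<union>| H |\<union>| G \<in> Y)"
      using r[of "H |\<union>| _"] by (simp add: funion_assoc) blast
  qed
qed

lemma saturated_below:
  fixes \<phi> :: "'g \<Rightarrow> 'l::frame"
  assumes "satisfies \<phi> E"
  shows "saturated E {F. (INF g\<in>fset F. \<phi> g) \<le> b}"
proof -
  have *: "(\<forall>F\<in>S. (INF g\<in>fset (F |\<union>| H). \<phi> g) \<le> b) \<longleftrightarrow> inf (interp \<phi> S) (INF g\<in>fset H. \<phi> g) \<le> b"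
    for S H
    by (simp add: interp_def SUP_inf_frame SUP_le_iff INF_union)
  show ?thesis
    unfolding saturated_def mem_Collect_eq
  proof (intro conjI ballI allI; clarsimp)
    fix F H assume "(INF g\<in>fset F. \<phi> g) \<le> b"
    then show "Inf (\<phi> ` (fset F \<union> fset H)) \<le> b"
      by (simp add: INF_union le_infI1)
  next
    fix S T H assume "(S, T) \<in> E"
    then have "interp \<phi> S = interp \<phi> T" using assms by (auto simp: satisfies_def)
    with *[of S H] *[of T H]
    show "(\<forall>F\<in>S. Inf (\<phi> ` (fset F \<union> fset H)) \<le> b) = (\<forall>F\<in>T. Inf (\<phi> ` (fset F \<union> fset H)) \<le> b)"
      by simp
  qed
qed


section \<open>The frame of reals\<close>

text \<open>\<open>RGt p\<close> is the generator \<open>(p, -)\<close> and \<open>RLt p\<close> is \<open>(-, p)\<close>.\<close>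

datatype real_gen = RGt rat | RLt rat

definition real_rels :: "(real_gen expr \<times> real_gen expr) set" where
  "real_rels =
     {({{|RGt p, RLt q|}}, {}) | p q. p \<ge> q} \<union>
     {({{|RGt p|}, {|RLt q|}}, {{||}}) | p q. p < q} \<union>
     {({{|RGt p|}}, {{|RGt q|} | q. q > p}) | p. True} \<union>
     {({{|RLt p|}}, {{|RLt q|} | q. q < p}) | p. True} \<union>
     {({{|RGt p|} | p. True}, {{||}})} \<union>
     {({{|RLt p|} | p. True}, {{||}})}"

typedef frame_of_reals = "{X. saturated real_rels X}"
  using saturated_UNIV by blast

setup_lifting type_definition_frame_of_reals

lemma saturated_inter2: "saturated E X \<Longrightarrow> saturated E Y \<Longrightarrow> saturated E (X \<inter> Y)"
  using saturated_Inter[of "{X, Y}" E] by auto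

lemma saturated_inter_closure:
  assumes "saturated E X" "\<And>Y. Y \<in> \<Y> \<Longrightarrow> saturated E Y"
  shows "X \<inter> \<Inter>{Z. saturated E Z \<and> \<Union>\<Y> \<subseteq> Z} = \<Inter>{Z. saturated E Z \<and> (\<Union>Y\<in>\<Y>. X \<inter> Y) \<subseteq> Z}"
proof (intro equalityI subsetI InterI)
  fix F Z
  assume F: "F \<in> X \<inter> \<Inter>{Z. saturated E Z \<and> \<Union>\<Y> \<subseteq> Z}"
    and Z: "Z \<in> {Z. saturated E Z \<and> (\<Union>Y\<in>\<Y>. X \<inter> Y) \<subseteq> Z}"
  have "F |\<union>| G \<in> Z" if "F \<in> Y" "Y \<in> \<Y>" "G \<in> X" for F G Y
  proof -
    have "F |\<union>| G \<in> Y" using assms(2)[OF that(2)] that by (auto simp: saturated_def)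
    moreover have "G |\<union>| F \<in> X" using assms(1) that unfolding saturated_def by blast
    ultimately show ?thesis using Z that by (auto simp: funion_commute)
  qed
  then have "\<Union>\<Y> \<subseteq> {F. \<forall>G\<in>X. F |\<union>| G \<in> Z}" by blast
  moreover have "saturated E {F. \<forall>G\<in>X. F |\<union>| G \<in> Z}" using Z by (intro saturated_imp) simp
  ultimately have "F \<in> {F. \<forall>G\<in>X. F |\<union>| G \<in> Z}" using F by blast
  then have "F |\<union>| F \<in> Z" using F by blast
  then show "F \<in> Z" by simp
next
  fix F
  assume F: "F \<in> \<Inter>{Z. saturated E Z \<and> (\<Union>Y\<in>\<Y>. X \<inter> Y) \<subseteq> Z}"
  have "F \<in> X" using F assms(1) by blast
  moreover have "F \<in> Z" if "saturated E Z" "\<Union>\<Y> \<subseteq> Z" for Z using F that by blast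
  ultimately show "F \<in> X \<inter> \<Inter>{Z. saturated E Z \<and> \<Union>\<Y> \<subseteq> Z}" by blast
qed

instantiation frame_of_reals :: frame
begin

lift_definition less_eq_frame_of_reals :: "frame_of_reals \<Rightarrow> frame_of_reals \<Rightarrow> bool" is "(\<subseteq>)" .
lift_definition less_frame_of_reals :: "frame_of_reals \<Rightarrow> frame_of_reals \<Rightarrow> bool" is "(\<subset>)" .
lift_definition top_frame_of_reals :: frame_of_reals is UNIV by (rule saturated_UNIV)
lift_definition bot_frame_of_reals :: frame_of_reals is "\<Inter>{Y. saturated real_rels Y}"
  by (rule saturated_Inter) simp
lift_definition inf_frame_of_reals :: "frame_of_reals \<Rightarrow> frame_of_reals \<Rightarrow> frame_of_reals" is "(\<inter>)"
  by (rule saturated_inter2)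
lift_definition sup_frame_of_reals :: "frame_of_reals \<Rightarrow> frame_of_reals \<Rightarrow> frame_of_reals"
  is "\<lambda>X Y. \<Inter>{Z. saturated real_rels Z \<and> X \<union> Y \<subseteq> Z}"
  by (rule saturated_Inter) simp
lift_definition Inf_frame_of_reals :: "frame_of_reals set \<Rightarrow> frame_of_reals" is "\<lambda>\<X>. \<Inter>\<X>"
  by (rule saturated_Inter) simp
lift_definition Sup_frame_of_reals :: "frame_of_reals set \<Rightarrow> frame_of_reals"
  is "\<lambda>\<X>. \<Inter>{Z. saturated real_rels Z \<and> \<Union>\<X> \<subseteq> Z}"
  by (rule saturated_Inter) simp

instance
proof
  fix a :: frame_of_reals and A :: "frame_of_reals set"
  show "inf a (Sup A) = (SUP x\<in>A. inf a x)"
    by transfer (rule saturated_inter_closure, auto)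
next
  fix x y z :: frame_of_reals and A :: "frame_of_reals set"
  show "(x < y) = (x \<le> y \<and> \<not> y \<le> x)" by transfer auto
  show "x \<le> x" by transfer auto
  show "x \<le> y \<Longrightarrow> y \<le> z \<Longrightarrow> x \<le> z" by transfer auto
  show "x \<le> y \<Longrightarrow> y \<le> x \<Longrightarrow> x = y" by transfer auto
  show "inf x y \<le> x" "inf x y \<le> y" by (transfer, auto)+
  show "x \<le> y \<Longrightarrow> x \<le> z \<Longrightarrow> x \<le> inf y z" by transfer auto
  show "x \<le> sup x y" "y \<le> sup x y" by (transfer, auto)+
  show "y \<le> x \<Longrightarrow> z \<le> x \<Longrightarrow> sup y z \<le> x" by transfer auto
  show "x \<in> A \<Longrightarrow> Inf A \<le> x" by transfer auto
  show "(\<And>x. x \<in> A \<Longrightarrow> z \<le> x) \<Longrightarrow> z \<le> Inf A" by transfer (rule Inter_greatest, blast)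
  show "x \<in> A \<Longrightarrow> x \<le> Sup A" by transfer auto
  show "(\<And>x. x \<in> A \<Longrightarrow> x \<le> z) \<Longrightarrow> Sup A \<le> z" by transfer (rule Inter_lower, blast)
  show "Inf {} = (top :: frame_of_reals)" by transfer auto
  show "Sup {} = (bot :: frame_of_reals)" by transfer auto
qed

end

lift_definition real_elem :: "real_gen expr \<Rightarrow> frame_of_reals"
  is "\<lambda>S. \<Inter>{Z. saturated real_rels Z \<and> S \<subseteq> Z}"
  by (rule saturated_Inter) simp

definition gen :: "real_gen \<Rightarrow> frame_of_reals" where
  "gen g = real_elem {{|g|}}"


lemma saturated_Rep: "saturated real_rels (Rep_frame_of_reals x)"
  using Rep_frame_of_reals by blast

lemma Rep_Un: "F \<in> Rep_frame_of_reals x \<Longrightarrow> F |\<union>| H \<in> Rep_frame_of_reals x"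
  using saturated_Rep[of x] by (auto simp: saturated_def)

lemma real_elem_le_iff: "real_elem S \<le> x \<longleftrightarrow> S \<subseteq> Rep_frame_of_reals x"
  by transfer blast

lemma subset_real_elem: "S \<subseteq> Rep_frame_of_reals (real_elem S)"
  using real_elem_le_iff[of S "real_elem S"] by simp

lemma real_elem_Rep: "real_elem (Rep_frame_of_reals x) = x"
  by transfer auto

lemma real_elem_induct:
  assumes "F \<in> Rep_frame_of_reals (real_elem S)" "saturated real_rels Z" "S \<subseteq> Z"
  shows "F \<in> Z"
  using assms by transfer blast

lemma real_elem_inf:
  "inf (real_elem S) (real_elem T) = real_elem {F |\<union>| G | F G. F \<in> S \<and> G \<in> T}"
  (is "_ = ?r")
proof (rule antisym)
  let ?Y = "Rep_frame_of_reals ?r"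
  have 1: "F |\<union>| G \<in> ?Y" if "F \<in> S" "G \<in> T" for F G
    by (rule subsetD[OF subset_real_elem]) (use that in auto)
  have 2: "F |\<union>| G \<in> ?Y" if F: "F \<in> Rep_frame_of_reals (real_elem S)" and "G \<in> T" for F G
  proof -
    have "F \<in> {F. \<forall>G\<in>T. F |\<union>| G \<in> ?Y}"
      by (rule real_elem_induct[OF F saturated_imp[OF saturated_Rep]]) (use 1 in auto)
    then show ?thesis using that by simp
  qed
  have 3: "F |\<union>| G \<in> ?Y"
    if F: "F \<in> Rep_frame_of_reals (real_elem S)" and G: "G \<in> Rep_frame_of_reals (real_elem T)" for F G
  proof -
    have "G \<in> {G. \<forall>F\<in>{F}. G |\<union>| F \<in> ?Y}"
      by (rule real_elem_induct[OF G saturated_imp[OF saturated_Rep]])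
        (use 2[OF F] in \<open>simp add: subset_iff funion_commute[of _ F]\<close>)
    then show ?thesis by (simp add: funion_commute)
  qed
  have "F \<in> ?Y" if "F \<in> Rep_frame_of_reals (real_elem S)" "F \<in> Rep_frame_of_reals (real_elem T)" for F
    using 3[OF that] by simp
  then show "inf (real_elem S) (real_elem T) \<le> ?r"
    unfolding less_eq_frame_of_reals.rep_eq inf_frame_of_reals.rep_eq by (intro subsetI) simp
  have "F |\<union>| G \<in> Rep_frame_of_reals (real_elem S) \<inter> Rep_frame_of_reals (real_elem T)"
    if "F \<in> S" "G \<in> T" for F G
  proof
    show "F |\<union>| G \<in> Rep_frame_of_reals (real_elem S)"
      by (rule Rep_Un, rule subsetD[OF subset_real_elem], rule that)
    show "F |\<union>| G \<in> Rep_frame_of_reals (real_elem T)"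
      unfolding funion_commute[of F]
      by (rule Rep_Un, rule subsetD[OF subset_real_elem], rule that)
  qed
  then show "?r \<le> inf (real_elem S) (real_elem T)"
    unfolding real_elem_le_iff inf_frame_of_reals.rep_eq by blast
qed

lemma real_elem_SUP: "real_elem S = (SUP F\<in>S. real_elem {F})"
proof (rule antisym)
  show "real_elem S \<le> (SUP F\<in>S. real_elem {F})"
    unfolding real_elem_le_iff
  proof
    fix F assume "F \<in> S"
    then have "real_elem {F} \<le> (SUP F\<in>S. real_elem {F})" by (rule SUP_upper)
    then show "F \<in> Rep_frame_of_reals (SUP F\<in>S. real_elem {F})"
      by (simp add: real_elem_le_iff)
  qed
  show "(SUP F\<in>S. real_elem {F}) \<le> real_elem S"
    by (rule SUP_least) (simp add: real_elem_le_iff subsetD[OF subset_real_elem])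
qed

lemma real_elem_empty: "real_elem {{||}} = top"
proof -
  have "{||} \<in> Rep_frame_of_reals (real_elem {{||}})" using subset_real_elem by blast
  then have "F \<in> Rep_frame_of_reals (real_elem {{||}})" for F using Rep_Un[of "{||}" _ F] by simp
  then show ?thesis
    by (auto simp: Rep_frame_of_reals_inject[symmetric] top_frame_of_reals.rep_eq)
qed

lemma INF_gen: "(INF g\<in>fset F. gen g) = real_elem {F}"
proof (induction F)
  case empty
  show ?case by (simp add: real_elem_empty)
next
  case (insert g F)
  have "(INF g\<in>fset (finsert g F). gen g) = inf (gen g) (real_elem {F})"
    using insert by simp
  also have "\<dots> = real_elem {finsert g F}"
    by (simp add: gen_def real_elem_inf)
  finally show ?case .
qed

lemma interp_gen: "interp gen S = real_elem S"
  by (simp add: interp_def INF_gen real_elem_SUP[of S])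

text \<open>The universal property: \<open>gen\<close> satisfies the relations, and every assignment of the generators
  that satisfies them extends to exactly one frame homomorphism.\<close>

lemma satisfies_gen: "satisfies gen real_rels"
proof -
  have "S \<subseteq> Rep_frame_of_reals x \<longleftrightarrow> T \<subseteq> Rep_frame_of_reals x" if "(S, T) \<in> real_rels" for S T x
  proof -
    have "(\<forall>F\<in>S. F |\<union>| {||} \<in> Rep_frame_of_reals x) \<longleftrightarrow> (\<forall>F\<in>T. F |\<union>| {||} \<in> Rep_frame_of_reals x)"
      using saturated_Rep[of x] that unfolding saturated_def by blast
    then show ?thesis by auto
  qed
  then have "real_elem S = real_elem T" if "(S, T) \<in> real_rels" for S T
    using that by (meson antisym order_refl real_elem_le_iff)
  then show ?thesis by (auto simp: satisfies_def interp_gen)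
qed

definition extend :: "(real_gen \<Rightarrow> 'l::frame) \<Rightarrow> frame_of_reals \<Rightarrow> 'l" where
  "extend \<phi> x = interp \<phi> (Rep_frame_of_reals x)"

lemma extend_real_elem:
  fixes \<phi> :: "real_gen \<Rightarrow> 'l::frame"
  assumes "satisfies \<phi> real_rels"
  shows "extend \<phi> (real_elem S) = interp \<phi> S"
proof (rule antisym)
  have "S \<subseteq> {F. (INF g\<in>fset F. \<phi> g) \<le> interp \<phi> S}"
    unfolding interp_def by (intro subsetI CollectI) (rule SUP_upper)
  then have "(INF g\<in>fset F. \<phi> g) \<le> interp \<phi> S" if "F \<in> Rep_frame_of_reals (real_elem S)" for F
    using real_elem_induct[OF that saturated_below[OF assms]] by blast
  then show "extend \<phi> (real_elem S) \<le> interp \<phi> S"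
    unfolding extend_def interp_def[of \<phi> "Rep_frame_of_reals _"] by (rule SUP_least)
  show "interp \<phi> S \<le> extend \<phi> (real_elem S)"
    unfolding extend_def interp_def by (rule SUP_subset_mono[OF subset_real_elem]) simp
qed

lemma extend_gen: "satisfies \<phi> real_rels \<Longrightarrow> extend \<phi> (gen g) = \<phi> g" for \<phi> :: "_ \<Rightarrow> 'l::frame"
  by (simp add: gen_def extend_real_elem) (simp add: interp_def)

lemma frame_hom_extend:
  fixes \<phi> :: "real_gen \<Rightarrow> 'l::frame"
  assumes "satisfies \<phi> real_rels"
  shows "frame_hom (extend \<phi>)"
  unfolding frame_hom_def
proof (intro conjI allI)
  show "extend \<phi> top = top"
    unfolding real_elem_empty[symmetric] extend_real_elem[OF assms] by (simp add: interp_def)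
next
  fix x y
  show "extend \<phi> (inf x y) = inf (extend \<phi> x) (extend \<phi> y)"
  proof (rule antisym)
    show "extend \<phi> (inf x y) \<le> inf (extend \<phi> x) (extend \<phi> y)"
      unfolding extend_def interp_def inf_frame_of_reals.rep_eq
      by (intro le_infI SUP_subset_mono) auto
    show "inf (extend \<phi> x) (extend \<phi> y) \<le> extend \<phi> (inf x y)"
      unfolding extend_def interp_def SUP_inf_SUP_frame
    proof (intro SUP_least)
      fix F G assume FG: "F \<in> Rep_frame_of_reals x" "G \<in> Rep_frame_of_reals y"
      have "F |\<union>| G \<in> Rep_frame_of_reals (inf x y)"
        using Rep_Un[OF FG(1), of G] Rep_Un[OF FG(2), of F]
        by (simp add: inf_frame_of_reals.rep_eq funion_commute)
      then have "(INF g\<in>fset (F |\<union>| G). \<phi> g)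
          \<le> (SUP F\<in>Rep_frame_of_reals (inf x y). INF g\<in>fset F. \<phi> g)"
        by (rule SUP_upper)
      then show "inf (INF g\<in>fset F. \<phi> g) (INF g\<in>fset G. \<phi> g)
          \<le> (SUP F\<in>Rep_frame_of_reals (inf x y). INF g\<in>fset F. \<phi> g)"
        by (simp add: INF_union)
    qed
  qed
next
  fix A :: "frame_of_reals set"
  have "Sup A = real_elem (\<Union>x\<in>A. Rep_frame_of_reals x)"
    by transfer simp
  then have "extend \<phi> (Sup A) = interp \<phi> (\<Union>x\<in>A. Rep_frame_of_reals x)"
    by (simp add: extend_real_elem[OF assms])
  then show "extend \<phi> (Sup A) = (SUP x\<in>A. extend \<phi> x)"
    by (simp only: extend_def interp_def SUP_UNION)
qed

lemma frame_hom_INF: "frame_hom f \<Longrightarrow> f (INF g\<in>fset F. \<phi> g) = (INF g\<in>fset F. f (\<phi> g))"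
  by (induction F) (auto simp: frame_hom_def)

lemma frame_hom_interp: "frame_hom f \<Longrightarrow> f (interp \<phi> S) = interp (\<lambda>g. f (\<phi> g)) S"
proof -
  assume f: "frame_hom f"
  then have "f (SUP F\<in>S. INF g\<in>fset F. \<phi> g) = (SUP F\<in>S. f (INF g\<in>fset F. \<phi> g))"
    by (simp add: frame_hom_def image_image)
  then show ?thesis by (simp add: interp_def frame_hom_INF[OF f])
qed

lemma frame_hom_eqI:
  assumes "frame_hom f" "frame_hom f'" "\<And>g. f (gen g) = f' (gen g)"
  shows "f = f'"
proof
  fix x
  have "f (interp gen (Rep_frame_of_reals x)) = f' (interp gen (Rep_frame_of_reals x))"
    unfolding assms(1,2)[THEN frame_hom_interp] assms(3) ..
  then show "f x = f' x" by (simp add: interp_gen real_elem_Rep)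
qed

lemma frame_hom_satisfies: "frame_hom f \<Longrightarrow> satisfies (\<lambda>g. f (gen g)) real_rels"
  using satisfies_gen unfolding satisfies_def frame_hom_interp[symmetric] by auto

definition real_assignment :: "(rat \<Rightarrow> 'l::complete_lattice) \<Rightarrow> (rat \<Rightarrow> 'l) \<Rightarrow> bool" where
  "real_assignment u v \<longleftrightarrow>
     (\<forall>p q. p \<ge> q \<longrightarrow> inf (u p) (v q) = bot) \<and>
     (\<forall>p q. p < q \<longrightarrow> sup (u p) (v q) = top) \<and>
     (\<forall>p. u p = (SUP q\<in>{p<..}. u q)) \<and>
     (\<forall>p. v p = (SUP q\<in>{..<p}. v q)) \<and>
     (SUP p. u p) = top \<and> (SUP p. v p) = top"

lemma satisfies_real_rels:
  "satisfies \<phi> real_rels \<longleftrightarrow> real_assignment (\<lambda>p. \<phi> (RGt p)) (\<lambda>p. \<phi> (RLt p))"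
proof -
  have sat_Un: "satisfies \<phi> (A \<union> B) \<longleftrightarrow> satisfies \<phi> A \<and> satisfies \<phi> B" for A B
    by (auto simp: satisfies_def)
  have i1: "interp \<phi> {F} = (INF g\<in>fset F. \<phi> g)" for F
    by (simp add: interp_def)
  have i2: "interp \<phi> {{|c q|} | q. P q} = (SUP q\<in>Collect P. \<phi> (c q))" for P and c :: "rat \<Rightarrow> _"
    by (simp add: interp_def setcompr_eq_image image_image)
  have i3: "interp \<phi> {F, G} = sup (INF g\<in>fset F. \<phi> g) (INF g\<in>fset G. \<phi> g)" for F G
    by (simp add: interp_def)
  have i4: "interp \<phi> {} = bot"
    by (simp add: interp_def)
  have s0: "satisfies \<phi> {(S, T)} \<longleftrightarrow> interp \<phi> S = interp \<phi> T" for S T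
    by (simp add: satisfies_def)
  have s1: "satisfies \<phi> {(S p, T p) | p. True} \<longleftrightarrow> (\<forall>p. interp \<phi> (S p) = interp \<phi> (T p))"
    for S T :: "rat \<Rightarrow> _"
    by (auto simp: satisfies_def)
  have s2: "satisfies \<phi> {(S p q, T p q) | p q. P p q} \<longleftrightarrow>
      (\<forall>p q. P p q \<longrightarrow> interp \<phi> (S p q) = interp \<phi> (T p q))" for S T :: "rat \<Rightarrow> rat \<Rightarrow> _" and P
    by (auto simp: satisfies_def)
  show ?thesis
    unfolding real_rels_def sat_Un s0 s1 s2 i2 i3 i1 i4 real_assignment_def
    by (simp add: greaterThan_def lessThan_def conj_assoc)
qed

section \<open>Continuous real functions on a frame\<close>

lemma real_assignmentI:
  assumes "\<And>p q. q \<le> p \<Longrightarrow> inf (u p) (v q) \<le> bot"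
    and "\<And>p q. p < q \<Longrightarrow> top \<le> sup (u p) (v q)"
    and "\<And>p q. p < q \<Longrightarrow> u q \<le> u p" "\<And>p. u p \<le> (SUP q\<in>{p<..}. u q)"
    and "\<And>p q. q < p \<Longrightarrow> v q \<le> v p" "\<And>p. v p \<le> (SUP q\<in>{..<p}. v q)"
    and "top \<le> (SUP p. u p)" "top \<le> (SUP p. v p)"
  shows "real_assignment u v"
  unfolding real_assignment_def
  using assms by (auto intro!: antisym SUP_least simp: bot_unique top_unique)

lemma real_assignment_zero:
  "real_assignment (\<lambda>p. if p < 0 then top else bot) (\<lambda>q. if 0 < q then top else bot :: 'l::frame)"
proof (rule real_assignmentI)
  show "(if p < 0 then top else bot :: 'l) \<le> (SUP q\<in>{p<..}. if q < 0 then top else bot)" for p :: rat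
    by (rule SUP_upper2[of "if p < 0 then p / 2 else p + 1"]) auto
  show "(if 0 < p then top else bot :: 'l) \<le> (SUP q\<in>{..<p}. if 0 < q then top else bot)" for p :: rat
    by (rule SUP_upper2[of "if 0 < p then p / 2 else p - 1"]) auto
  show "top \<le> (SUP p::rat. if p < 0 then top else bot :: 'l)"
    by (rule SUP_upper2[of "-1"]) auto
  show "top \<le> (SUP p::rat. if 0 < p then top else bot :: 'l)"
    by (rule SUP_upper2[of 1]) auto
qed auto

typedef (overloaded) 'l cont_real = "{f :: frame_of_reals \<Rightarrow> 'l::frame. frame_hom f}"
proof -
  let ?\<phi> = "\<lambda>g. case g of RGt p \<Rightarrow> if p < 0 then top else bot :: 'l | RLt q \<Rightarrow> if 0 < q then top else bot"
  have "satisfies ?\<phi> real_rels"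
    unfolding satisfies_real_rels real_gen.case by (rule real_assignment_zero)
  from frame_hom_extend[OF this] show ?thesis by blast
qed

text \<open>\<open>gt_val f p\<close> is \<open>f(p, -)\<close> and \<open>lt_val f q\<close> is \<open>f(-, q)\<close>.\<close>

definition gt_val :: "'l::frame cont_real \<Rightarrow> rat \<Rightarrow> 'l" where
  "gt_val f p = Rep_cont_real f (gen (RGt p))"

definition lt_val :: "'l::frame cont_real \<Rightarrow> rat \<Rightarrow> 'l" where
  "lt_val f q = Rep_cont_real f (gen (RLt q))"

text \<open>The frame homomorphism with prescribed values on the generators; meaningful if
  \<^term>\<open>real_assignment u v\<close>, see \<open>gt_val_real_hom\<close> and \<open>lt_val_real_hom\<close> below.\<close>

definition real_hom :: "(rat \<Rightarrow> 'l) \<Rightarrow> (rat \<Rightarrow> 'l) \<Rightarrow> 'l::frame cont_real" where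
  "real_hom u v = (THE f. (\<forall>p. gt_val f p = u p) \<and> (\<forall>q. lt_val f q = v q))"

lemma real_assignment_vals: "real_assignment (gt_val f) (lt_val f)"
proof -
  have "frame_hom (Rep_cont_real f)" using Rep_cont_real by blast
  from frame_hom_satisfies[OF this] show ?thesis
    unfolding satisfies_real_rels gt_val_def[abs_def] lt_val_def[abs_def] .
qed

lemma cont_real_eqI:
  assumes "\<And>p. gt_val f p = gt_val g p" "\<And>q. lt_val f q = lt_val g q"
  shows "f = g"
proof -
  have "Rep_cont_real f = Rep_cont_real g"
  proof (rule frame_hom_eqI)
    show "frame_hom (Rep_cont_real f)" "frame_hom (Rep_cont_real g)" using Rep_cont_real by blast+
    show "Rep_cont_real f (gen x) = Rep_cont_real g (gen x)" for x
      using assms by (cases x) (simp_all add: gt_val_def lt_val_def)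
  qed
  then show ?thesis by (simp add: Rep_cont_real_inject)
qed

lemma real_hom_vals:
  assumes "real_assignment u v"
  shows "(\<forall>p. gt_val (real_hom u v) p = u p) \<and> (\<forall>q. lt_val (real_hom u v) q = v q)"
proof -
  define \<phi> where "\<phi> = (\<lambda>g. case g of RGt p \<Rightarrow> u p | RLt q \<Rightarrow> v q)"
  have sat: "satisfies \<phi> real_rels" using assms by (simp add: satisfies_real_rels \<phi>_def)
  have "Rep_cont_real (Abs_cont_real (extend \<phi>)) = extend \<phi>"
    using frame_hom_extend[OF sat] by (simp add: Abs_cont_real_inverse)
  then have vals: "(\<forall>p. gt_val (Abs_cont_real (extend \<phi>)) p = u p) \<and>
      (\<forall>q. lt_val (Abs_cont_real (extend \<phi>)) q = v q)"
    by (simp add: gt_val_def lt_val_def extend_gen[OF sat]) (simp add: \<phi>_def)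
  show ?thesis
    unfolding real_hom_def by (rule theI, rule vals, rule cont_real_eqI) (simp_all add: vals)
qed

lemma gt_val_real_hom: "real_assignment u v \<Longrightarrow> gt_val (real_hom u v) p = u p"
  and lt_val_real_hom: "real_assignment u v \<Longrightarrow> lt_val (real_hom u v) q = v q"
  using real_hom_vals by blast+

context
  fixes f :: "'l::frame cont_real"
begin

lemma gt_lt_bot: "q \<le> p \<Longrightarrow> inf (gt_val f p) (lt_val f q) = bot"
  and gt_lt_top: "p < q \<Longrightarrow> sup (gt_val f p) (lt_val f q) = top"
  and gt_SUP: "gt_val f p = (SUP q\<in>{p<..}. gt_val f q)"
  and lt_SUP: "lt_val f p = (SUP q\<in>{..<p}. lt_val f q)"
  and SUP_gt: "(SUP p. gt_val f p) = top"
  and SUP_lt: "(SUP p. lt_val f p) = top"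
  using real_assignment_vals[of f] unfolding real_assignment_def by blast+

lemma gt_mono: "p \<le> q \<Longrightarrow> gt_val f q \<le> gt_val f p"
  using gt_SUP[of p] by (cases "p = q") (auto intro!: SUP_upper)

lemma lt_mono: "p \<le> q \<Longrightarrow> lt_val f p \<le> lt_val f q"
  using lt_SUP[of q] by (cases "p = q") (auto intro!: SUP_upper)

lemma gt_leI: "(\<And>q. p < q \<Longrightarrow> inf (gt_val f q) c \<le> b) \<Longrightarrow> inf (gt_val f p) c \<le> b"
  by (subst gt_SUP) (auto simp: SUP_inf_frame intro: SUP_least)

lemma lt_leI: "(\<And>q. q < p \<Longrightarrow> inf (lt_val f q) c \<le> b) \<Longrightarrow> inf (lt_val f p) c \<le> b"
  by (subst lt_SUP) (auto simp: SUP_inf_frame intro: SUP_least)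

lemma interval_cover:
  assumes "d > 0"
  shows "(SUP r. inf (gt_val f r) (lt_val f (r + d))) = top" (is "?J = _")
proof -
  have J: "inf (gt_val f r) (lt_val f s) \<le> ?J" if "s \<le> r + d" for r s
    by (rule SUP_upper2[of r]) (auto intro: le_infI2 lt_mono that)
  have *: "inf (gt_val f a) (lt_val f (a + of_nat n * (d/2))) \<le> ?J" for a n
  proof (induction n)
    case 0
    show ?case by (simp add: gt_lt_bot)
  next
    case (Suc n)
    let ?m = "a + of_nat n * (d/2)"
    show ?case
    proof (rule frame_cover_sup[of "gt_val f (?m - d/2)" "lt_val f ?m"])
      show "sup (gt_val f (?m - d/2)) (lt_val f ?m) = top" using assms by (intro gt_lt_top) simp
      have "inf (gt_val f (?m - d/2)) (lt_val f (a + of_nat (Suc n) * (d/2))) \<le> ?J"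
        by (rule J) (simp add: algebra_simps)
      then show "inf (inf (gt_val f a) (lt_val f (a + of_nat (Suc n) * (d/2)))) (gt_val f (?m - d/2)) \<le> ?J"
        by (rule order_trans[rotated]) (auto intro: le_infI1)
      show "inf (inf (gt_val f a) (lt_val f (a + of_nat (Suc n) * (d/2)))) (lt_val f ?m) \<le> ?J"
        by (rule order_trans[OF _ Suc]) (auto intro: le_infI1)
    qed
  qed
  have "inf (gt_val f a) (lt_val f b) \<le> ?J" for a b
  proof -
    obtain n where "(b - a) / (d/2) \<le> of_nat n" by (metis real_arch_simple)
    then have "b \<le> a + of_nat n * (d/2)" using assms by (simp add: field_simps)
    then show ?thesis by (intro order_trans[OF _ *[of a n]]) (auto intro: le_infI2 lt_mono)
  qed
  then have "inf (SUP a. gt_val f a) (SUP b. lt_val f b) \<le> ?J"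
    unfolding SUP_inf_SUP_frame by (intro SUP_least)
  then show ?thesis by (simp add: SUP_gt SUP_lt top_unique)
qed

end

lemma sup_inf_disjoint:
  fixes a :: "'l::frame"
  assumes "inf a c = bot" "inf b d = bot"
  shows "inf (sup a b) (inf c d) \<le> bot"
proof -
  have "inf (inf c d) (sup a b) \<le> sup (inf a c) (inf b d)"
    unfolding inf_sup_frame by (intro sup_mono) (auto intro: le_infI1)
  then show ?thesis using assms by (simp add: inf_commute)
qed

lemma sup_inf_cover:
  fixes a :: "'l::frame"
  assumes "sup a c = top" "sup b d = top"
  shows "top \<le> sup (sup a b) (inf c d)"
proof -
  have "inf (sup a c) (sup b d) \<le> sup (sup a b) (inf c d)"
    unfolding sup_inf_frame by (intro inf_mono) (auto intro: le_supI1)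
  then show ?thesis using assms by simp
qed

lemma lt_val_antimono:
  assumes "\<And>p. gt_val f p \<le> gt_val g p"
  shows "lt_val g q \<le> lt_val f q"
proof -
  have "inf (lt_val g q') top \<le> lt_val f q" if "q' < q" for q'
  proof (rule frame_cover_sup[of "gt_val f q'" "lt_val f q"])
    show "sup (gt_val f q') (lt_val f q) = top" by (rule gt_lt_top[OF that])
    have "inf (gt_val g q') (lt_val g q') = bot" by (rule gt_lt_bot) simp
    then have "inf (lt_val g q') (gt_val f q') \<le> bot"
      using assms[of q'] by (metis inf_commute inf_mono order_refl)
    then show "inf (inf (lt_val g q') top) (gt_val f q') \<le> lt_val f q"
      unfolding inf_top_right by (rule order_trans) simp
  qed simp
  from lt_leI[of q g top, OF this] show ?thesis by simp
qed

lemma cont_real_gt_eqI: "(\<And>p. gt_val f p = gt_val g p) \<Longrightarrow> f = g"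
  by (rule cont_real_eqI) (auto intro!: antisym lt_val_antimono)

text \<open>In the definitions below, where the usual description of an operation only lists its values
  on the generators \<open>(p, -)\<close>, the values on \<open>(-, q)\<close> are the ones these force.\<close>

instantiation cont_real :: (frame) lattice
begin

definition less_eq_cont_real :: "'a cont_real \<Rightarrow> 'a cont_real \<Rightarrow> bool" where
  "f \<le> g \<longleftrightarrow> (\<forall>p. gt_val f p \<le> gt_val g p)"

definition less_cont_real :: "'a cont_real \<Rightarrow> 'a cont_real \<Rightarrow> bool" where
  "(f :: 'a cont_real) < g \<longleftrightarrow> f \<le> g \<and> \<not> g \<le> f"

definition sup_cont_real :: "'a cont_real \<Rightarrow> 'a cont_real \<Rightarrow> 'a cont_real" where
  "sup f g = real_hom (\<lambda>p. sup (gt_val f p) (gt_val g p)) (\<lambda>q. inf (lt_val f q) (lt_val g q))"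

definition inf_cont_real :: "'a cont_real \<Rightarrow> 'a cont_real \<Rightarrow> 'a cont_real" where
  "inf f g = real_hom (\<lambda>p. inf (gt_val f p) (gt_val g p)) (\<lambda>q. sup (lt_val f q) (lt_val g q))"

lemma real_assignment_sup:
  "real_assignment (\<lambda>p. sup (gt_val f p) (gt_val g p)) (\<lambda>q. inf (lt_val f q) (lt_val g q))"
  for f g :: "'a cont_real"
proof (rule real_assignmentI)
  fix p q :: rat assume "q \<le> p"
  then show "inf (sup (gt_val f p) (gt_val g p)) (inf (lt_val f q) (lt_val g q)) \<le> bot"
    by (intro sup_inf_disjoint gt_lt_bot)
next
  fix p q :: rat assume "p < q"
  then show "top \<le> sup (sup (gt_val f p) (gt_val g p)) (inf (lt_val f q) (lt_val g q))"
    by (intro sup_inf_cover gt_lt_top)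
next
  fix p
  show "sup (gt_val f p) (gt_val g p) \<le> (SUP q\<in>{p<..}. sup (gt_val f q) (gt_val g q))"
    by (subst (1 2) gt_SUP) (simp add: SUP_sup_distrib)
next
  fix q
  show "inf (lt_val f q) (lt_val g q) \<le> (SUP q\<in>{..<q}. inf (lt_val f q) (lt_val g q))"
  proof (rule lt_leI, subst inf_commute, rule lt_leI, subst inf_commute)
    fix r s assume "r < q" "s < q"
    then show "inf (lt_val f r) (lt_val g s) \<le> (SUP q\<in>{..<q}. inf (lt_val f q) (lt_val g q))"
      by (intro SUP_upper2[of "max r s"] inf_mono lt_mono) auto
  qed
next
  show "top \<le> (SUP p. sup (gt_val f p) (gt_val g p))"
    by (simp add: SUP_sup_distrib[symmetric] SUP_gt)
next
  have "inf (SUP p. lt_val f p) (SUP p. lt_val g p) \<le> (SUP q. inf (lt_val f q) (lt_val g q))"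
    unfolding SUP_inf_SUP_frame
  proof (intro SUP_least)
    fix r s
    show "inf (lt_val f r) (lt_val g s) \<le> (SUP q. inf (lt_val f q) (lt_val g q))"
      by (intro SUP_upper2[of "max r s"] inf_mono lt_mono) auto
  qed
  then show "top \<le> (SUP q. inf (lt_val f q) (lt_val g q))" by (simp add: SUP_lt)
qed (blast intro: sup_mono inf_mono gt_mono lt_mono less_imp_le)+

lemma real_assignment_inf:
  "real_assignment (\<lambda>p. inf (gt_val f p) (gt_val g p)) (\<lambda>q. sup (lt_val f q) (lt_val g q))"
  for f g :: "'a cont_real"
proof (rule real_assignmentI)
  fix p q :: rat assume "q \<le> p"
  then show "inf (inf (gt_val f p) (gt_val g p)) (sup (lt_val f q) (lt_val g q)) \<le> bot"
    by (subst inf_commute, intro sup_inf_disjoint) (auto simp: inf_commute[of "lt_val _ _"] gt_lt_bot)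
next
  fix p q :: rat assume "p < q"
  then show "top \<le> sup (inf (gt_val f p) (gt_val g p)) (sup (lt_val f q) (lt_val g q))"
    by (subst sup_commute, intro sup_inf_cover) (auto simp: sup_commute[of "lt_val _ _"] gt_lt_top)
next
  fix q
  show "sup (lt_val f q) (lt_val g q) \<le> (SUP q\<in>{..<q}. sup (lt_val f q) (lt_val g q))"
    by (subst (1 2) lt_SUP) (simp add: SUP_sup_distrib)
next
  fix q
  show "inf (gt_val f q) (gt_val g q) \<le> (SUP q\<in>{q<..}. inf (gt_val f q) (gt_val g q))"
  proof (rule gt_leI, subst inf_commute, rule gt_leI, subst inf_commute)
    fix r s assume "q < r" "q < s"
    then show "inf (gt_val f r) (gt_val g s) \<le> (SUP q\<in>{q<..}. inf (gt_val f q) (gt_val g q))"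
      by (intro SUP_upper2[of "min r s"] inf_mono gt_mono) auto
  qed
next
  show "top \<le> (SUP p. sup (lt_val f p) (lt_val g p))"
    by (simp add: SUP_sup_distrib[symmetric] SUP_lt)
next
  have "inf (SUP p. gt_val f p) (SUP p. gt_val g p) \<le> (SUP q. inf (gt_val f q) (gt_val g q))"
    unfolding SUP_inf_SUP_frame
  proof (intro SUP_least)
    fix r s
    show "inf (gt_val f r) (gt_val g s) \<le> (SUP q. inf (gt_val f q) (gt_val g q))"
      by (intro SUP_upper2[of "min r s"] inf_mono gt_mono) auto
  qed
  then show "top \<le> (SUP q. inf (gt_val f q) (gt_val g q))" by (simp add: SUP_gt)
qed (blast intro: sup_mono inf_mono gt_mono lt_mono less_imp_le)+

lemmas gt_val_sup = gt_val_real_hom[OF real_assignment_sup, folded sup_cont_real_def]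
  and lt_val_sup = lt_val_real_hom[OF real_assignment_sup, folded sup_cont_real_def]
  and gt_val_inf = gt_val_real_hom[OF real_assignment_inf, folded inf_cont_real_def]
  and lt_val_inf = lt_val_real_hom[OF real_assignment_inf, folded inf_cont_real_def]

instance
proof
  fix f g h :: "'a cont_real"
  show "(f < g) = (f \<le> g \<and> \<not> g \<le> f)" by (rule less_cont_real_def)
  show "f \<le> g \<Longrightarrow> g \<le> f \<Longrightarrow> f = g"
    by (rule cont_real_gt_eqI) (simp add: less_eq_cont_real_def antisym)
qed (auto simp: less_eq_cont_real_def gt_val_sup gt_val_inf intro: order_trans)

end

lemma gt_val_mono: "f \<le> g \<Longrightarrow> gt_val f p \<le> gt_val g p"
  by (simp add: less_eq_cont_real_def)

lemma cont_real_leI: "(\<And>p. gt_val f p \<le> gt_val g p) \<Longrightarrow> f \<le> g"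
  by (simp add: less_eq_cont_real_def)

instantiation cont_real :: (frame) ab_group_add
begin

definition zero_cont_real :: "'a cont_real" where
  "0 = real_hom (\<lambda>p. if p < 0 then top else bot) (\<lambda>q. if 0 < q then top else bot)"

definition plus_cont_real :: "'a cont_real \<Rightarrow> 'a cont_real \<Rightarrow> 'a cont_real" where
  "f + g = real_hom (\<lambda>p. SUP r. inf (gt_val f r) (gt_val g (p - r)))
                    (\<lambda>q. SUP s. inf (lt_val f s) (lt_val g (q - s)))"

definition uminus_cont_real :: "'a cont_real \<Rightarrow> 'a cont_real" where
  "- f = real_hom (\<lambda>p. lt_val f (- p)) (\<lambda>q. gt_val f (- q))"

definition minus_cont_real :: "'a cont_real \<Rightarrow> 'a cont_real \<Rightarrow> 'a cont_real" where
  "f - g = f + - (g :: 'a cont_real)"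

lemma real_assignment_uminus: "real_assignment (\<lambda>p. lt_val f (- p)) (\<lambda>q. gt_val f (- q))"
  for f :: "'a cont_real"
proof (rule real_assignmentI)
  fix p
  have "lt_val f (- p) = (SUP q\<in>{..<- p}. lt_val f q)" by (rule lt_SUP)
  also have "\<dots> \<le> (SUP q\<in>{p<..}. lt_val f (- q))"
    by (rule SUP_least) (rule SUP_upper2[of "- _"], auto)
  finally show "lt_val f (- p) \<le> (SUP q\<in>{p<..}. lt_val f (- q))" .
  have "gt_val f (- p) = (SUP q\<in>{- p<..}. gt_val f q)" by (rule gt_SUP)
  also have "\<dots> \<le> (SUP q\<in>{..<p}. gt_val f (- q))"
    by (rule SUP_least) (rule SUP_upper2[of "- _"], auto)
  finally show "gt_val f (- p) \<le> (SUP q\<in>{..<p}. gt_val f (- q))" .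
next
  show "top \<le> (SUP p. lt_val f (- p))"
    unfolding SUP_lt[of f, symmetric] by (rule SUP_least) (rule SUP_upper2[of "- _"], auto)
  show "top \<le> (SUP p. gt_val f (- p))"
    unfolding SUP_gt[of f, symmetric] by (rule SUP_least) (rule SUP_upper2[of "- _"], auto)
next
  fix p q :: rat
  show "inf (lt_val f (- p)) (gt_val f (- q)) \<le> bot" if "q \<le> p"
    using that by (subst inf_commute) (simp add: gt_lt_bot)
  show "top \<le> sup (lt_val f (- p)) (gt_val f (- q))" if "p < q"
    using that by (subst sup_commute) (simp add: gt_lt_top)
qed (simp_all add: gt_mono lt_mono)

lemma real_assignment_plus:
  "real_assignment (\<lambda>p. SUP r. inf (gt_val f r) (gt_val g (p - r)))
                   (\<lambda>q. SUP s. inf (lt_val f s) (lt_val g (q - s)))"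
  (is "real_assignment ?u ?v") for f g :: "'a cont_real"
proof -
  have u: "inf (gt_val f r) (gt_val g s) \<le> ?u p" if "p \<le> r + s" for p r s
    by (rule SUP_upper2[of r], simp, rule inf_mono[OF order_refl gt_mono]) (use that in simp)
  have v: "inf (lt_val f r) (lt_val g s) \<le> ?v p" if "r + s \<le> p" for p r s
    by (rule SUP_upper2[of r], simp, rule inf_mono[OF order_refl lt_mono]) (use that in simp)
  show ?thesis
  proof (rule real_assignmentI)
    fix p q :: rat assume pq: "q \<le> p"
    show "inf (?u p) (?v q) \<le> bot"
      unfolding SUP_inf_SUP_frame
    proof (intro SUP_least)
      fix r s
      show "inf (inf (gt_val f r) (gt_val g (p - r))) (inf (lt_val f s) (lt_val g (q - s))) \<le> bot"
      proof (cases "s \<le> r")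
        case True
        then have "inf (gt_val f r) (lt_val f s) \<le> bot" by (simp add: gt_lt_bot)
        then show ?thesis by (rule order_trans[rotated]) (auto intro: le_infI1 le_infI2)
      next
        case False
        then have "inf (gt_val g (p - r)) (lt_val g (q - s)) \<le> bot" using pq by (simp add: gt_lt_bot)
        then show ?thesis by (rule order_trans[rotated]) (auto intro: le_infI1 le_infI2)
      qed
    qed
  next
    fix p q :: rat assume pq: "p < q"
    let ?d = "(q - p) / 2"
    have d: "?d > 0" using pq by simp
    show "top \<le> sup (?u p) (?v q)"
    proof (rule frame_cover_SUP[OF interval_cover[OF d, of f]],
        rule frame_cover_SUP[OF interval_cover[OF d, of g]])
      fix r s
      let ?c = "inf (inf top (inf (gt_val f r) (lt_val f (r + ?d)))) (inf (gt_val g s) (lt_val g (s + ?d)))"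
      have "?c \<le> inf (gt_val f r) (gt_val g s)" "?c \<le> inf (lt_val f (r + ?d)) (lt_val g (s + ?d))"
        by (auto intro: le_infI1 le_infI2)
      moreover have "inf (gt_val f r) (gt_val g s) \<le> ?u p \<or>
          inf (lt_val f (r + ?d)) (lt_val g (s + ?d)) \<le> ?v q"
      proof (cases "p \<le> r + s")
        case False
        then have "(r + ?d) + (s + ?d) \<le> q" by (simp add: field_simps)
        from v[OF this] show ?thesis ..
      qed (use u in blast)
      ultimately show "?c \<le> sup (?u p) (?v q)"
        by (meson le_supI1 le_supI2 order_trans)
    qed
  next
    fix p q :: rat assume "p < q"
    then show "?u q \<le> ?u p" by (intro SUP_mono' inf_mono order_refl gt_mono) simp
  next
    fix p q :: rat assume "q < p"
    then show "?v q \<le> ?v p" by (intro SUP_mono' inf_mono order_refl lt_mono) simp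
  next
    fix p
    show "?u p \<le> (SUP q\<in>{p<..}. ?u q)"
    proof (rule SUP_least, rule gt_leI)
      fix r q :: rat assume "r < q"
      then show "inf (gt_val f q) (gt_val g (p - r)) \<le> (SUP q\<in>{p<..}. ?u q)"
        by (intro SUP_upper2[of "q + (p - r)"] u) auto
    qed
    show "?v p \<le> (SUP q\<in>{..<p}. ?v q)"
    proof (rule SUP_least, rule lt_leI)
      fix r q :: rat assume "q < r"
      then show "inf (lt_val f q) (lt_val g (p - r)) \<le> (SUP q\<in>{..<p}. ?v q)"
        by (intro SUP_upper2[of "q + (p - r)"] v) auto
    qed
  next
    have "inf (SUP p. gt_val f p) (SUP p. gt_val g p) \<le> (SUP p. ?u p)"
      unfolding SUP_inf_SUP_frame by (intro SUP_least) (rule SUP_upper2, rule UNIV_I, rule u, rule order_refl)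
    then show "top \<le> (SUP p. ?u p)" by (simp only: SUP_gt inf_top_left)
    have "inf (SUP p. lt_val f p) (SUP p. lt_val g p) \<le> (SUP p. ?v p)"
      unfolding SUP_inf_SUP_frame by (intro SUP_least) (rule SUP_upper2, rule UNIV_I, rule v, rule order_refl)
    then show "top \<le> (SUP p. ?v p)" by (simp only: SUP_lt inf_top_left)
  qed
qed

lemmas gt_val_zero = gt_val_real_hom[OF real_assignment_zero[where 'l = 'a], folded zero_cont_real_def]
  and lt_val_zero = lt_val_real_hom[OF real_assignment_zero[where 'l = 'a], folded zero_cont_real_def]
  and gt_val_plus = gt_val_real_hom[OF real_assignment_plus, folded plus_cont_real_def]
  and lt_val_plus = lt_val_real_hom[OF real_assignment_plus, folded plus_cont_real_def]
  and gt_val_uminus = gt_val_real_hom[OF real_assignment_uminus, folded uminus_cont_real_def]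
  and lt_val_uminus = lt_val_real_hom[OF real_assignment_uminus, folded uminus_cont_real_def]

lemma gt_plusI: "p \<le> r + s \<Longrightarrow> inf (gt_val f r) (gt_val g s) \<le> gt_val (f + g) p"
  for f g :: "'a cont_real"
  unfolding gt_val_plus by (rule SUP_upper2[of r], simp, rule inf_mono[OF order_refl gt_mono]) simp

lemma gt_plus_leI:
  "(\<And>r s. r + s = p \<Longrightarrow> inf (inf (gt_val f r) (gt_val g s)) c \<le> b) \<Longrightarrow> inf (gt_val (f + g) p) c \<le> b"
  for f g :: "'a cont_real"
  unfolding gt_val_plus SUP_inf_frame by (rule SUP_least) simp

lemma gt_plus_leI':
  "(\<And>r s. r + s = p \<Longrightarrow> inf (gt_val f r) (gt_val g s) \<le> b) \<Longrightarrow> gt_val (f + g) p \<le> b"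
  for f g :: "'a cont_real"
  unfolding gt_val_plus by (rule SUP_least) simp

instance
proof
  have comm_le: "f + g \<le> g + f" for f g :: "'a cont_real"
    by (intro cont_real_leI gt_plus_leI') (subst inf_commute, rule gt_plusI, simp)
  then have comm: "f + g = g + f" for f g :: "'a cont_real"
    by (intro antisym)
  have assoc_le: "(f + g) + h \<le> f + (g + h)" for f g h :: "'a cont_real"
  proof (intro cont_real_leI gt_plus_leI' gt_plus_leI)
    fix p r s r' s' :: rat assume p: "r + s = p" "r' + s' = r"
    have "inf (gt_val g s') (gt_val h s) \<le> gt_val (g + h) (s' + s)" by (rule gt_plusI) simp
    then have "inf (gt_val f r') (inf (gt_val g s') (gt_val h s)) \<le> inf (gt_val f r') (gt_val (g + h) (s' + s))"
      by (intro inf_mono) auto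
    also have "\<dots> \<le> gt_val (f + (g + h)) p" by (rule gt_plusI) (use p in simp)
    finally show "inf (inf (gt_val f r') (gt_val g s')) (gt_val h s) \<le> gt_val (f + (g + h)) p"
      by (simp add: inf_assoc)
  qed
  fix f g h :: "'a cont_real"
  show "f + g = g + f" by (rule comm)
  show "f + g + h = f + (g + h)"
  proof (rule antisym[OF assoc_le])
    have "(h + g) + f \<le> h + (g + f)" by (rule assoc_le)
    then show "f + (g + h) \<le> f + g + h" by (metis comm)
  qed
  show "0 + f = f"
  proof (intro antisym cont_real_leI)
    fix p
    show "gt_val (0 + f) p \<le> gt_val f p"
      by (rule gt_plus_leI') (auto simp: gt_val_zero intro!: gt_mono)
    have "inf (gt_val f p) top \<le> gt_val (0 + f) p"
    proof (rule gt_leI)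
      fix q :: rat assume "p < q"
      then have "inf (gt_val 0 (p - q)) (gt_val f q) \<le> gt_val (0 + f) p" by (intro gt_plusI) simp
      then show "inf (gt_val f q) top \<le> gt_val (0 + f) p" using \<open>p < q\<close> by (simp add: gt_val_zero)
    qed
    then show "gt_val f p \<le> gt_val (0 + f) p" by simp
  qed
  show "- f + f = 0"
  proof (intro antisym cont_real_leI)
    fix p
    show "gt_val (- f + f) p \<le> gt_val 0 p"
    proof (rule gt_plus_leI')
      fix r s :: rat assume rs: "r + s = p"
      show "inf (gt_val (- f) r) (gt_val f s) \<le> gt_val 0 p"
      proof (cases "p < 0")
        case False
        then have "inf (gt_val f s) (lt_val f (- r)) = bot" using rs by (intro gt_lt_bot) simp
        then show ?thesis by (simp add: gt_val_uminus inf_commute)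
      qed (simp add: gt_val_zero)
    qed
    show "gt_val 0 p \<le> gt_val (- f + f) p"
    proof (cases "p < 0")
      case True
      then have "0 < - p" by simp
      have "(SUP r. inf (gt_val f r) (lt_val f (r + - p))) \<le> gt_val (- f + f) p"
      proof (rule SUP_least)
        fix r
        have "inf (gt_val (- f) (p - r)) (gt_val f r) \<le> gt_val (- f + f) p" by (rule gt_plusI) simp
        then show "inf (gt_val f r) (lt_val f (r + - p)) \<le> gt_val (- f + f) p"
          by (simp add: gt_val_uminus inf_commute)
      qed
      then show ?thesis unfolding interval_cover[OF \<open>0 < - p\<close>] by (simp add: top_unique)
    qed (simp add: gt_val_zero)
  qed
  show "f - g = f + - g" by (rule minus_cont_real_def)
qed

end

instance cont_real :: (frame) ordered_ab_group_add
proof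
  fix f g h :: "'a cont_real"
  assume "f \<le> g"
  then show "h + f \<le> h + g"
    by (intro cont_real_leI gt_plus_leI')
      (rule order_trans[OF inf_mono[OF order_refl gt_val_mono] gt_plusI], auto)
qed

definition pos_scale :: "real \<Rightarrow> 'l::frame cont_real \<Rightarrow> 'l cont_real" where
  "pos_scale c f = real_hom (\<lambda>p. SUP r\<in>{r. c * of_rat r > of_rat p}. gt_val f r)
                            (\<lambda>q. SUP s\<in>{s. c * of_rat s < of_rat q}. lt_val f s)"

lemma real_assignment_scale:
  fixes f :: "'l::frame cont_real" and c :: real
  assumes c: "c > 0"
  shows "real_assignment (\<lambda>p. SUP r\<in>{r. c * of_rat r > of_rat p}. gt_val f r)
                         (\<lambda>q. SUP s\<in>{s. c * of_rat s < of_rat q}. lt_val f s)"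
    (is "real_assignment ?u ?v")
proof (rule real_assignmentI)
  fix p q :: rat assume "q \<le> p"
  then have pq: "of_rat q \<le> (of_rat p :: real)" by (simp add: of_rat_less_eq)
  show "inf (?u p) (?v q) \<le> bot"
    unfolding SUP_inf_SUP_frame
  proof (intro SUP_least; clarify)
    fix r s :: rat assume "of_rat p < c * of_rat r" "c * of_rat s < of_rat q"
    then have "c * of_rat s < c * of_rat r" using pq by linarith
    then have "s \<le> r" using c by (simp add: of_rat_less)
    then show "inf (gt_val f r) (lt_val f s) \<le> bot" by (simp add: gt_lt_bot)
  qed
next
  fix p q :: rat assume "p < q"
  then have "of_rat p / c < of_rat q / c" using c by (simp add: divide_strict_right_mono of_rat_less)
  then obtain r where r: "of_rat p / c < of_rat r" "of_rat r < of_rat q / c" by (meson of_rat_dense)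
  then obtain s where s: "of_rat r < (of_rat s :: real)" "of_rat s < of_rat q / c" by (meson of_rat_dense)
  have "top = sup (gt_val f r) (lt_val f s)" using s(1) by (simp add: gt_lt_top of_rat_less)
  also have "\<dots> \<le> sup (?u p) (?v q)"
    by (intro sup_mono SUP_upper) (use r s c in \<open>auto simp: field_simps\<close>)
  finally show "top \<le> sup (?u p) (?v q)" .
next
  fix p q :: rat assume "p < q"
  then have "of_rat p < (of_rat q :: real)" by (simp add: of_rat_less)
  then show "?u q \<le> ?u p" by (intro SUP_subset_mono) auto
next
  fix p q :: rat assume "q < p"
  then have "of_rat q < (of_rat p :: real)" by (simp add: of_rat_less)
  then show "?v q \<le> ?v p" by (intro SUP_subset_mono) auto
next
  fix p
  show "?u p \<le> (SUP q\<in>{p<..}. ?u q)"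
  proof (rule SUP_least, clarify)
    fix r :: rat assume "of_rat p < c * of_rat r"
    then obtain q where q: "of_rat p < (of_rat q :: real)" "of_rat q < c * of_rat r" by (meson of_rat_dense)
    have "gt_val f r \<le> ?u q" by (rule SUP_upper) (use q in simp)
    also have "\<dots> \<le> (SUP q\<in>{p<..}. ?u q)" by (rule SUP_upper) (use q in \<open>simp add: of_rat_less\<close>)
    finally show "gt_val f r \<le> (SUP q\<in>{p<..}. ?u q)" .
  qed
  show "?v p \<le> (SUP q\<in>{..<p}. ?v q)"
  proof (rule SUP_least, clarify)
    fix r :: rat assume "c * of_rat r < of_rat p"
    then obtain q where q: "c * of_rat r < of_rat q" "of_rat q < (of_rat p :: real)" by (meson of_rat_dense)
    have "lt_val f r \<le> ?v q" by (rule SUP_upper) (use q in simp)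
    also have "\<dots> \<le> (SUP q\<in>{..<p}. ?v q)" by (rule SUP_upper) (use q in \<open>simp add: of_rat_less\<close>)
    finally show "lt_val f r \<le> (SUP q\<in>{..<p}. ?v q)" .
  qed
next
  have "gt_val f r \<le> (SUP p. ?u p)" for r
  proof -
    obtain q where "of_rat q < c * of_rat r" by (meson of_rat_dense lt_ex)
    then show ?thesis by (intro SUP_upper2[of q] SUP_upper) auto
  qed
  then show "top \<le> (SUP p. ?u p)" unfolding SUP_gt[of f, symmetric] by (rule SUP_least)
  have "lt_val f r \<le> (SUP p. ?v p)" for r
  proof -
    obtain q where "c * of_rat r < of_rat q" by (meson of_rat_dense gt_ex)
    then show ?thesis by (intro SUP_upper2[of q] SUP_upper) auto
  qed
  then show "top \<le> (SUP p. ?v p)" unfolding SUP_lt[of f, symmetric] by (rule SUP_least)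
qed

lemmas gt_val_scale = gt_val_real_hom[OF real_assignment_scale, folded pos_scale_def]
  and lt_val_scale = lt_val_real_hom[OF real_assignment_scale, folded pos_scale_def]

lemma gt_scaleI: "c > 0 \<Longrightarrow> of_rat p < c * of_rat r \<Longrightarrow> gt_val f r \<le> gt_val (pos_scale c f) p"
  for f :: "'l::frame cont_real"
  by (simp add: gt_val_scale SUP_upper)

lemma gt_scale_leI:
  "c > 0 \<Longrightarrow> (\<And>r. of_rat p < c * of_rat r \<Longrightarrow> inf (gt_val f r) d \<le> b) \<Longrightarrow>
    inf (gt_val (pos_scale c f) p) d \<le> b"
  for f :: "'l::frame cont_real"
  by (auto simp: gt_val_scale SUP_inf_frame intro!: SUP_least)

lemma gt_scale_leI':
  "c > 0 \<Longrightarrow> (\<And>r. of_rat p < c * of_rat r \<Longrightarrow> gt_val f r \<le> b) \<Longrightarrow> gt_val (pos_scale c f) p \<le> b"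
  for f :: "'l::frame cont_real"
  by (auto simp: gt_val_scale intro!: SUP_least)

lemma pos_scale_add_right: "c > 0 \<Longrightarrow> pos_scale c (f + g) = pos_scale c f + pos_scale c g"
  for f g :: "'l::frame cont_real"
proof (intro antisym cont_real_leI)
  fix p assume c: "c > 0"
  show "gt_val (pos_scale c (f + g)) p \<le> gt_val (pos_scale c f + pos_scale c g) p"
  proof (intro gt_scale_leI' c gt_plus_leI')
    fix r a b :: rat assume "of_rat p < c * of_rat r" "a + b = r"
    then have "of_rat p - c * of_rat b < c * of_rat a" by (auto simp: of_rat_add algebra_simps)
    then obtain x where x: "of_rat p - c * of_rat b < of_rat x" "of_rat x < c * of_rat a"
      by (meson of_rat_dense)
    have "inf (gt_val f a) (gt_val g b) \<le> inf (gt_val (pos_scale c f) x) (gt_val (pos_scale c g) (p - x))"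
      by (intro inf_mono gt_scaleI c) (use x in \<open>auto simp: of_rat_diff\<close>)
    also have "\<dots> \<le> gt_val (pos_scale c f + pos_scale c g) p" by (rule gt_plusI) simp
    finally show "inf (gt_val f a) (gt_val g b) \<le> gt_val (pos_scale c f + pos_scale c g) p" .
  qed
  show "gt_val (pos_scale c f + pos_scale c g) p \<le> gt_val (pos_scale c (f + g)) p"
  proof (intro gt_plus_leI' gt_scale_leI c, subst inf_commute, intro gt_scale_leI c, subst inf_commute)
    fix x y a b :: rat
    assume "x + y = p" "of_rat x < c * of_rat a" "of_rat y < c * of_rat b"
    then have "of_rat p < c * of_rat (a + b)" by (auto simp: of_rat_add algebra_simps)
    have "inf (gt_val f a) (gt_val g b) \<le> gt_val (f + g) (a + b)" by (rule gt_plusI) simp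
    also have "\<dots> \<le> gt_val (pos_scale c (f + g)) p" by (rule gt_scaleI) fact+
    finally show "inf (gt_val f a) (gt_val g b) \<le> gt_val (pos_scale c (f + g)) p" .
  qed
qed

lemma pos_scale_add_left: "c > 0 \<Longrightarrow> d > 0 \<Longrightarrow> pos_scale (c + d) f = pos_scale c f + pos_scale d f"
  for f :: "'l::frame cont_real"
proof (intro antisym cont_real_leI)
  fix p assume c: "c > 0" and d: "d > 0"
  then have cd: "c + d > 0" by simp
  show "gt_val (pos_scale (c + d) f) p \<le> gt_val (pos_scale c f + pos_scale d f) p"
  proof (intro gt_scale_leI' cd)
    fix r :: rat assume "of_rat p < (c + d) * of_rat r"
    then have "of_rat p - d * of_rat r < c * of_rat r" by (simp add: algebra_simps)
    then obtain x where x: "of_rat p - d * of_rat r < of_rat x" "of_rat x < c * of_rat r"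
      by (meson of_rat_dense)
    have "inf (gt_val f r) (gt_val f r) \<le> inf (gt_val (pos_scale c f) x) (gt_val (pos_scale d f) (p - x))"
      by (intro inf_mono gt_scaleI c d) (use x in \<open>auto simp: of_rat_diff\<close>)
    also have "\<dots> \<le> gt_val (pos_scale c f + pos_scale d f) p" by (rule gt_plusI) simp
    finally show "gt_val f r \<le> gt_val (pos_scale c f + pos_scale d f) p" by simp
  qed
  show "gt_val (pos_scale c f + pos_scale d f) p \<le> gt_val (pos_scale (c + d) f) p"
  proof (intro gt_plus_leI' gt_scale_leI c, subst inf_commute, intro gt_scale_leI d, subst inf_commute)
    fix x y a b :: rat
    assume xy: "x + y = p" "of_rat x < c * of_rat a" "of_rat y < d * of_rat b"
    have "of_rat a \<le> (of_rat (max a b) :: real)" "of_rat b \<le> (of_rat (max a b) :: real)"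
      by (simp_all add: of_rat_less_eq)
    then have "c * of_rat a \<le> c * of_rat (max a b)" "d * of_rat b \<le> d * of_rat (max a b)"
      using c d by simp_all
    then have "of_rat p < (c + d) * of_rat (max a b)" using xy by (auto simp: of_rat_add algebra_simps)
    then have "gt_val f (max a b) \<le> gt_val (pos_scale (c + d) f) p" by (intro gt_scaleI cd)
    then show "inf (gt_val f a) (gt_val f b) \<le> gt_val (pos_scale (c + d) f) p"
      by (rule order_trans[rotated]) (simp add: max_def)
  qed
qed

lemma pos_scale_scale: "c > 0 \<Longrightarrow> d > 0 \<Longrightarrow> pos_scale c (pos_scale d f) = pos_scale (c * d) f"
  for f :: "'l::frame cont_real"
proof (intro antisym cont_real_leI)
  fix p assume c: "c > 0" and d: "d > 0"
  then have cd: "c * d > 0" by simp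
  show "gt_val (pos_scale c (pos_scale d f)) p \<le> gt_val (pos_scale (c * d) f) p"
  proof (intro gt_scale_leI' c d gt_scaleI cd)
    fix r s :: rat assume "of_rat p < c * of_rat r" "of_rat r < d * of_rat s"
    then have "of_rat p < c * (d * of_rat s)" using c by (meson less_trans mult_strict_left_mono)
    then show "of_rat p < c * d * of_rat s" by (simp add: mult.assoc)
  qed
  show "gt_val (pos_scale (c * d) f) p \<le> gt_val (pos_scale c (pos_scale d f)) p"
  proof (intro gt_scale_leI' cd)
    fix r :: rat assume "of_rat p < c * d * of_rat r"
    then have "of_rat p / c < d * of_rat r" using c by (simp add: field_simps)
    then obtain x where x: "of_rat p / c < of_rat x" "of_rat x < d * of_rat r" by (meson of_rat_dense)
    have "gt_val f r \<le> gt_val (pos_scale d f) x" by (intro gt_scaleI d x)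
    also have "\<dots> \<le> gt_val (pos_scale c (pos_scale d f)) p"
      by (intro gt_scaleI c) (use c x in \<open>simp add: field_simps\<close>)
    finally show "gt_val f r \<le> gt_val (pos_scale c (pos_scale d f)) p" .
  qed
qed

lemma pos_scale_one: "pos_scale 1 f = f" for f :: "'l::frame cont_real"
proof (rule cont_real_gt_eqI)
  fix p
  have "gt_val (pos_scale 1 f) p = (SUP q\<in>{p<..}. gt_val f q)"
    by (simp add: gt_val_scale of_rat_less greaterThan_def)
  then show "gt_val (pos_scale 1 f) p = gt_val f p" by (simp add: gt_SUP[of f p])
qed

lemma pos_scale_uminus:
  fixes f :: "'l::frame cont_real"
  assumes "c > 0"
  shows "pos_scale c (- f) = - pos_scale c f"
proof -
  have "pos_scale c (- f) + pos_scale c (- f) + pos_scale c f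
      = pos_scale c (- f + - f + f)"
    using assms by (simp only: pos_scale_add_right)
  also have "\<dots> = pos_scale c (- f)" by simp
  finally show ?thesis by (simp add: eq_neg_iff_add_eq_0)
qed

lemma pos_scale_zero: "c > 0 \<Longrightarrow> pos_scale c 0 = (0 :: 'l::frame cont_real)"
  using pos_scale_add_right[of c 0 "0 :: 'l::frame cont_real"] by simp

lemma pos_scale_diff: "0 < d \<Longrightarrow> d < c \<Longrightarrow> pos_scale (c - d) f = pos_scale c f - pos_scale d f"
  for f :: "'l::frame cont_real"
  using pos_scale_add_left[of "c - d" d f] by (simp add: eq_diff_eq)

instantiation cont_real :: (frame) real_vector
begin

definition scaleR_cont_real :: "real \<Rightarrow> 'a cont_real \<Rightarrow> 'a cont_real" where
  "c *\<^sub>R f = (if c > 0 then pos_scale c f else if c = 0 then 0 else - pos_scale (- c) f)"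

instance
proof
  fix a b :: real and f g :: "'a cont_real"
  show "a *\<^sub>R (f + g) = a *\<^sub>R f + a *\<^sub>R g"
    by (auto simp: scaleR_cont_real_def pos_scale_add_right)
  show "(a + b) *\<^sub>R f = a *\<^sub>R f + b *\<^sub>R f"
  proof -
    have neg: "(- c) *\<^sub>R f = - (c *\<^sub>R f)" for c by (simp add: scaleR_cont_real_def)
    have 2: "(a + b) *\<^sub>R f = a *\<^sub>R f + b *\<^sub>R f" if "a > 0" for a b
    proof -
      consider "b > 0" | "b = 0" | "b < 0" "a + b > 0" | "a + b = 0" | "a + b < 0" by linarith
      then show ?thesis
      proof cases
        case 1
        then show ?thesis using that by (simp add: scaleR_cont_real_def pos_scale_add_left)
      next
        case 2
        then show ?thesis by (simp add: scaleR_cont_real_def)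
      next
        case 3
        then show ?thesis using that pos_scale_diff[of "- b" a f] by (simp add: scaleR_cont_real_def)
      next
        case 4
        then have "b = - a" by simp
        then show ?thesis using that by (simp add: scaleR_cont_real_def)
      next
        case 5
        then have "pos_scale (- b - a) f = pos_scale (- b) f - pos_scale a f"
          using that by (intro pos_scale_diff) auto
        moreover have "- b - a = - (a + b)" by simp
        ultimately have "pos_scale (- (a + b)) f = pos_scale (- b) f - pos_scale a f" by (simp only:)
        then show ?thesis
          using 5 that by (simp add: scaleR_cont_real_def del: minus_add_distrib)
      qed
    qed
    consider "a > 0" | "a = 0" | "- a > 0" by linarith
    then show ?thesis
    proof cases
      case 3
      have "- ((a + b) *\<^sub>R f) = (- a + - b) *\<^sub>R f" by (simp only: neg[symmetric] minus_add_distrib)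
      also have "\<dots> = - (a *\<^sub>R f + b *\<^sub>R f)" unfolding 2[OF 3] neg by simp
      finally show ?thesis by (simp only: neg_equal_iff_equal)
    qed (use 2 in \<open>auto simp: scaleR_cont_real_def\<close>)
  qed
  show "a *\<^sub>R b *\<^sub>R f = (a * b) *\<^sub>R f"
    by (auto simp: scaleR_cont_real_def pos_scale_scale pos_scale_uminus pos_scale_zero
        zero_less_mult_iff mult_less_0_iff not_less)
  show "1 *\<^sub>R f = f" by (simp add: scaleR_cont_real_def pos_scale_one)
qed

end

class riesz_space = ordered_real_vector + lattice_ab_group_add_abs

instantiation cont_real :: (frame) riesz_space
begin

definition abs_cont_real :: "'a cont_real \<Rightarrow> 'a cont_real" where
  "\<bar>f\<bar> = sup f (- f :: 'a cont_real)"

lemma scaleR_nonneg: "0 \<le> c \<Longrightarrow> 0 \<le> f \<Longrightarrow> 0 \<le> c *\<^sub>R f" for f :: "'a cont_real"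
proof (cases "c > 0")
  case True
  assume f: "0 \<le> f"
  have "pos_scale c 0 \<le> pos_scale c f"
    by (intro cont_real_leI) (auto simp: gt_val_scale True intro!: SUP_mono gt_val_mono f)
  then show ?thesis using True by (simp add: scaleR_cont_real_def pos_scale_zero)
qed (simp add: scaleR_cont_real_def)

instance
proof
  fix a b :: real and f g :: "'a cont_real"
  show "f \<le> g \<Longrightarrow> 0 \<le> a \<Longrightarrow> a *\<^sub>R f \<le> a *\<^sub>R g"
    using scaleR_nonneg[of a "g - f"] by (simp add: scaleR_diff_right)
  show "a \<le> b \<Longrightarrow> 0 \<le> f \<Longrightarrow> a *\<^sub>R f \<le> b *\<^sub>R f"
    using scaleR_nonneg[of "b - a" f] by (simp add: scaleR_diff_left)
  show "\<bar>f\<bar> = sup f (- f)" by (rule abs_cont_real_def)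
qed

end

section \<open>Bands\<close>

class archimedean_riesz_space = riesz_space +
  assumes archimedean: "0 \<le> f \<Longrightarrow> (\<And>n::nat. real n *\<^sub>R f \<le> g) \<Longrightarrow> f = 0"

definition lat_disjoint :: "'a::riesz_space \<Rightarrow> 'a \<Rightarrow> bool" where
  "lat_disjoint f g \<longleftrightarrow> inf \<bar>f\<bar> \<bar>g\<bar> = 0"

definition riesz_ideal :: "'a::riesz_space set \<Rightarrow> bool" where
  "riesz_ideal A \<longleftrightarrow> subspace A \<and> (\<forall>f\<in>A. \<forall>g\<in>A. sup f g \<in> A \<and> inf f g \<in> A) \<and>
     (\<forall>f\<in>A. \<forall>g. \<bar>g\<bar> \<le> \<bar>f\<bar> \<longrightarrow> g \<in> A)"

definition is_band :: "'a::riesz_space set \<Rightarrow> bool" where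
  "is_band A \<longleftrightarrow> riesz_ideal A \<and> (\<forall>S s. S \<subseteq> A \<and> isLub UNIV S s \<longrightarrow> s \<in> A)"

lemma isLub_UNIV_iff:
  "isLub UNIV S s \<longleftrightarrow> (\<forall>x\<in>S. x \<le> s) \<and> (\<forall>u. (\<forall>x\<in>S. x \<le> u) \<longrightarrow> s \<le> u)" for s :: "'a::order"
  by (auto simp: isLub_def leastP_def isUb_def setle_def setge_def)

lemma is_band_Inter: "(\<And>A. A \<in> \<A> \<Longrightarrow> is_band A) \<Longrightarrow> is_band (\<Inter>\<A>)"
  unfolding is_band_def riesz_ideal_def subspace_def by blast

lemma is_band_UNIV: "is_band UNIV"
  by (simp add: is_band_def riesz_ideal_def subspace_UNIV)

lemma inf_add_le:
  fixes a b c :: "'a::riesz_space"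
  assumes "0 \<le> a" "0 \<le> b" "0 \<le> c"
  shows "inf (a + b) c \<le> inf a c + inf b c"
proof -
  have "c \<le> a + c" "c \<le> c + b" "c \<le> c + c" using assms by auto
  then have "inf (a + b) c \<le> a + c" "inf (a + b) c \<le> c + b" "inf (a + b) c \<le> c + c"
    by (auto intro: le_infI2)
  then show ?thesis by (simp add: add_sup_inf_distribs)
qed

lemma disjoint_commute: "lat_disjoint f g \<Longrightarrow> lat_disjoint g f"
  by (simp add: lat_disjoint_def inf_commute)

lemma disjointI: "inf \<bar>f\<bar> \<bar>g\<bar> \<le> 0 \<Longrightarrow> lat_disjoint f g"
  unfolding lat_disjoint_def by (rule antisym) auto

lemma disjoint_solid: "lat_disjoint f h \<Longrightarrow> \<bar>g\<bar> \<le> \<bar>f\<bar> \<Longrightarrow> lat_disjoint g h"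
  by (rule disjointI) (metis lat_disjoint_def inf_mono order_refl)

lemma disjoint_add:
  assumes "lat_disjoint f h" "lat_disjoint g h"
  shows "lat_disjoint (f + g) h"
proof (rule disjointI)
  have "inf \<bar>f + g\<bar> \<bar>h\<bar> \<le> inf (\<bar>f\<bar> + \<bar>g\<bar>) \<bar>h\<bar>"
    by (intro inf_mono abs_triangle_ineq order_refl)
  also have "\<dots> \<le> inf \<bar>f\<bar> \<bar>h\<bar> + inf \<bar>g\<bar> \<bar>h\<bar>" by (rule inf_add_le) auto
  finally show "inf \<bar>f + g\<bar> \<bar>h\<bar> \<le> 0" using assms by (simp add: lat_disjoint_def)
qed

lemma abs_scaleR_le: "\<bar>c *\<^sub>R f\<bar> \<le> \<bar>c\<bar> *\<^sub>R \<bar>f\<bar>" for f :: "'a::riesz_space"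
proof -
  have *: "c *\<^sub>R f \<le> \<bar>c\<bar> *\<^sub>R \<bar>f\<bar>" for f :: 'a
  proof (cases "0 \<le> c")
    case True
    then show ?thesis using scaleR_left_mono[OF abs_ge_self[of f] True] by simp
  next
    case False
    then have "(- c) *\<^sub>R (- f) \<le> (- c) *\<^sub>R \<bar>f\<bar>" by (intro scaleR_left_mono) (auto simp: abs_ge_minus_self)
    then show ?thesis using False by simp
  qed
  show ?thesis using *[of f] *[of "- f"] by (intro abs_leI) simp_all
qed

lemma disjoint_scaleR:
  assumes "lat_disjoint f h"
  shows "lat_disjoint (c *\<^sub>R f) h"
proof -
  have m: "lat_disjoint (real n *\<^sub>R \<bar>f\<bar>) h" for n
  proof (induction n)
    case 0
    show ?case by (simp add: lat_disjoint_def inf_absorb1)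
  next
    case (Suc n)
    have "lat_disjoint \<bar>f\<bar> h" using assms by (simp add: lat_disjoint_def)
    moreover have "real (Suc n) *\<^sub>R \<bar>f\<bar> = \<bar>f\<bar> + real n *\<^sub>R \<bar>f\<bar>" by (simp add: scaleR_left_distrib)
    ultimately show ?case using disjoint_add[OF _ Suc] by simp
  qed
  obtain n where "\<bar>c\<bar> \<le> real n" by (meson real_arch_simple)
  then have "\<bar>c\<bar> *\<^sub>R \<bar>f\<bar> \<le> real n *\<^sub>R \<bar>f\<bar>" by (intro scaleR_right_mono) auto
  then have "\<bar>c *\<^sub>R f\<bar> \<le> real n *\<^sub>R \<bar>f\<bar>" using abs_scaleR_le order_trans by blast
  also have "\<dots> \<le> \<bar>real n *\<^sub>R \<bar>f\<bar>\<bar>" by (rule abs_ge_self)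
  finally show ?thesis by (rule disjoint_solid[OF m])
qed

lemma abs_sup_le: "\<bar>sup f g\<bar> \<le> \<bar>f\<bar> + \<bar>g\<bar>" for f g :: "'a::riesz_space"
proof -
  have "f \<le> \<bar>f\<bar> + \<bar>g\<bar>" "g \<le> \<bar>f\<bar> + \<bar>g\<bar>" "- f \<le> \<bar>f\<bar> + \<bar>g\<bar>"
    by (simp_all add: add_increasing2 add_increasing abs_ge_self abs_ge_minus_self)
  then show ?thesis by (intro abs_leI) (auto intro: le_infI1)
qed

lemma disjoint_sup: "lat_disjoint f h \<Longrightarrow> lat_disjoint g h \<Longrightarrow> lat_disjoint (sup f g) h"
proof -
  assume "lat_disjoint f h" "lat_disjoint g h"
  then have "lat_disjoint (\<bar>f\<bar> + \<bar>g\<bar>) h" by (intro disjoint_add) (auto simp: lat_disjoint_def)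
  then show ?thesis using abs_sup_le[of f g] by (elim disjoint_solid) simp
qed

lemma disjoint_uminus: "lat_disjoint (- f) h \<longleftrightarrow> lat_disjoint f h"
  by (simp add: lat_disjoint_def)

lemma disjoint_inf: "lat_disjoint f h \<Longrightarrow> lat_disjoint g h \<Longrightarrow> lat_disjoint (inf f g) h"
  using disjoint_sup[of "- f" h "- g"] disjoint_uminus[of "inf f g" h]
  by (simp add: disjoint_uminus)

lemma pprt_le_abs: "pprt f \<le> \<bar>f\<bar>" for f :: "'a::riesz_space"
  by (simp add: pprt_def abs_ge_self)

lemma disjoint_isLub:
  fixes s :: "'a::riesz_space"
  assumes s: "isLub UNIV S s" and d: "\<And>f. f \<in> S \<Longrightarrow> lat_disjoint f h"
  shows "lat_disjoint s h"
proof -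
  have ub: "f \<le> s" if "f \<in> S" for f using s that by (simp add: isLub_UNIV_iff)
  have least: "s \<le> u" if "\<And>f. f \<in> S \<Longrightarrow> f \<le> u" for u using s that by (simp add: isLub_UNIV_iff)
  show ?thesis
  proof (cases "S = {}")
    case True
    then have "s \<le> s - \<bar>s\<bar>" by (intro least) auto
    then have "s = 0" by (simp add: le_diff_eq)
    then show ?thesis by (simp add: lat_disjoint_def inf_absorb1)
  next
    case False
    then obtain f0 where f0: "f0 \<in> S" by blast
    let ?x = "inf (pprt s) \<bar>h\<bar>"
    have "f \<le> pprt s - ?x" if f: "f \<in> S" for f
    proof -
      have "inf (pprt f) \<bar>h\<bar> \<le> inf \<bar>f\<bar> \<bar>h\<bar>" by (intro inf_mono pprt_le_abs order_refl)
      moreover have "inf (pprt f) ?x \<le> inf (pprt f) \<bar>h\<bar>" by (intro inf_mono order_refl inf_le2)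
      moreover have "inf \<bar>f\<bar> \<bar>h\<bar> = 0" using d[OF f] by (simp only: lat_disjoint_def)
      ultimately have "inf (pprt f) ?x \<le> 0" by (metis order_trans)
      moreover have "0 \<le> inf (pprt f) ?x" by simp
      ultimately have "pprt f + ?x = sup (pprt f) ?x" using add_eq_inf_sup[of "pprt f" ?x] by simp
      also have "\<dots> \<le> pprt s" using ub[OF f] by (simp add: pprt_mono)
      finally have "pprt f \<le> pprt s - ?x" by (simp only: le_diff_eq)
      moreover have "f \<le> pprt f" by (simp add: pprt_def)
      ultimately show ?thesis by (rule order_trans[rotated])
    qed
    then have "s \<le> pprt s - ?x" by (rule least)
    moreover have "0 \<le> pprt s - ?x" by (simp only: diff_ge_0_iff_ge inf_le1)
    ultimately have "pprt s \<le> pprt s - ?x" by (simp only: pprt_def sup_least)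
    then have "?x \<le> 0" by (simp only: le_diff_eq add_le_same_cancel1)
    then have 1: "lat_disjoint (pprt s) h" by (intro disjointI) simp
    have "pprt (- s) \<le> pprt (- f0)" using ub[OF f0] by (intro pprt_mono) simp
    also have "\<dots> \<le> \<bar>f0\<bar>" using pprt_le_abs[of "- f0"] by simp
    finally have 2: "lat_disjoint (pprt (- s)) h" by (intro disjoint_solid[OF d[OF f0]]) simp
    have "s = pprt s + - pprt (- s)" using prts[of s] by (simp add: pprt_neg)
    with disjoint_add[OF 1, of "- pprt (- s)"] 2 show ?thesis
      by (simp only: disjoint_uminus)
  qed
qed

lemma is_band_disjoint: "is_band {f. \<forall>g\<in>A. lat_disjoint f g}"
  unfolding is_band_def riesz_ideal_def subspace_def
  by (auto simp: disjoint_add disjoint_scaleR disjoint_sup disjoint_inf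
      intro: disjoint_solid disjoint_isLub) (simp add: lat_disjoint_def inf_absorb1)

typedef (overloaded) 'a band = "{A :: 'a::riesz_space set. is_band A}"
  using is_band_UNIV by blast

setup_lifting type_definition_band

instantiation band :: (riesz_space) complete_lattice
begin

lift_definition less_eq_band :: "'a band \<Rightarrow> 'a band \<Rightarrow> bool" is "(\<subseteq>)" .
lift_definition less_band :: "'a band \<Rightarrow> 'a band \<Rightarrow> bool" is "(\<subset>)" .
lift_definition top_band :: "'a band" is UNIV by (rule is_band_UNIV)
lift_definition bot_band :: "'a band" is "\<Inter>{A. is_band A}"
  by (rule is_band_Inter) simp
lift_definition inf_band :: "'a band \<Rightarrow> 'a band \<Rightarrow> 'a band" is "\<lambda>A B. A \<inter> B"
  using is_band_Inter[of "{_, _}"] by auto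
lift_definition sup_band :: "'a band \<Rightarrow> 'a band \<Rightarrow> 'a band"
  is "\<lambda>A B. \<Inter>{C. is_band C \<and> A \<union> B \<subseteq> C}"
  by (rule is_band_Inter) simp
lift_definition Inf_band :: "'a band set \<Rightarrow> 'a band" is "\<lambda>\<A>. \<Inter>\<A>"
  by (rule is_band_Inter) simp
lift_definition Sup_band :: "'a band set \<Rightarrow> 'a band" is "\<lambda>\<A>. \<Inter>{C. is_band C \<and> \<Union>\<A> \<subseteq> C}"
  by (rule is_band_Inter) simp

instance
proof
  fix x y z :: "'a band" and A :: "'a band set"
  show "(x < y) = (x \<le> y \<and> \<not> y \<le> x)" by transfer auto
  show "x \<le> x" by transfer auto
  show "x \<le> y \<Longrightarrow> y \<le> z \<Longrightarrow> x \<le> z" by transfer auto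
  show "x \<le> y \<Longrightarrow> y \<le> x \<Longrightarrow> x = y" by transfer auto
  show "inf x y \<le> x" "inf x y \<le> y" by (transfer, auto)+
  show "x \<le> y \<Longrightarrow> x \<le> z \<Longrightarrow> x \<le> inf y z" by transfer auto
  show "x \<le> sup x y" "y \<le> sup x y" by (transfer, auto)+
  show "y \<le> x \<Longrightarrow> z \<le> x \<Longrightarrow> sup y z \<le> x" by transfer auto
  show "x \<in> A \<Longrightarrow> Inf A \<le> x" by transfer auto
  show "(\<And>x. x \<in> A \<Longrightarrow> z \<le> x) \<Longrightarrow> z \<le> Inf A" by transfer (rule Inter_greatest, blast)
  show "x \<in> A \<Longrightarrow> x \<le> Sup A" by transfer auto
  show "(\<And>x. x \<in> A \<Longrightarrow> x \<le> z) \<Longrightarrow> Sup A \<le> z" by transfer (rule Inter_lower, blast)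
  show "Inf {} = (top :: 'a band)" by transfer auto
  show "Sup {} = (bot :: 'a band)" by transfer auto
qed

end

lift_definition generated_band :: "'a::riesz_space \<Rightarrow> 'a band" is "\<lambda>f. \<Inter>{A. is_band A \<and> f \<in> A}"
  by (rule is_band_Inter) simp

instantiation band :: (riesz_space) "{uminus, minus}"
begin

lift_definition uminus_band :: "'a band \<Rightarrow> 'a band" is "\<lambda>A. {f. \<forall>g\<in>A. lat_disjoint f g}"
  by (rule is_band_disjoint)

definition minus_band :: "'a band \<Rightarrow> 'a band \<Rightarrow> 'a band" where
  "minus_band A B = inf A (- B)"

instance ..

end

lemma is_band_Rep: "is_band (Rep_band A)"
  using Rep_band by blast

lemma band_le_iff: "A \<le> B \<longleftrightarrow> (\<forall>f. f \<in> Rep_band A \<longrightarrow> f \<in> Rep_band B)"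
  by (auto simp: less_eq_band.rep_eq)

lemma in_inf_band: "f \<in> Rep_band (inf A B) \<longleftrightarrow> f \<in> Rep_band A \<and> f \<in> Rep_band B"
  by (simp add: inf_band.rep_eq)

lemma in_uminus_band: "f \<in> Rep_band (- A) \<longleftrightarrow> (\<forall>g\<in>Rep_band A. lat_disjoint f g)"
  by (simp add: uminus_band.rep_eq)

lemma band_solid: "f \<in> Rep_band A \<Longrightarrow> \<bar>g\<bar> \<le> \<bar>f\<bar> \<Longrightarrow> g \<in> Rep_band A"
  using is_band_Rep[of A] by (auto simp: is_band_def riesz_ideal_def)

lemma band_subspace: "subspace (Rep_band A)"
  using is_band_Rep[of A] by (auto simp: is_band_def riesz_ideal_def)

lemma band_isLub: "S \<subseteq> Rep_band A \<Longrightarrow> isLub UNIV S s \<Longrightarrow> s \<in> Rep_band A"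
  using is_band_Rep[of A] by (auto simp: is_band_def)

lemma band_zero: "0 \<in> Rep_band A"
  using band_subspace by (rule subspace_0)

lemma disjoint_self: "lat_disjoint f f \<longleftrightarrow> f = 0"
  by (simp add: lat_disjoint_def)

lemma in_bot_band: "f \<in> Rep_band bot \<longleftrightarrow> f = 0"
proof
  assume "f \<in> Rep_band bot"
  then have "f \<in> Rep_band (- top)" using bot_least[of "- top :: 'a band"] by (simp add: band_le_iff)
  then show "f = 0" by (simp add: in_uminus_band top_band.rep_eq disjoint_self[symmetric])
qed (simp add: band_zero)

lemma band_double_compl:
  fixes A :: "'a::archimedean_riesz_space band"
  shows "- (- A) = A"
proof (rule antisym)
  show "A \<le> - (- A)" by (auto simp: band_le_iff in_uminus_band intro: disjoint_commute)
  have pos: "f \<in> Rep_band A" if f: "f \<in> Rep_band (- (- A))" "0 \<le> f" for f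
  proof -
    let ?S = "{a. a \<in> Rep_band A \<and> 0 \<le> a \<and> a \<le> f}"
    have "f \<le> u" if u: "\<And>a. a \<in> ?S \<Longrightarrow> a \<le> u" for u
    proof -
      define g where "g = inf u f"
      define h where "h = f - g"
      have g: "a \<le> g" if "a \<in> ?S" for a using u[OF that] that by (simp add: g_def)
      have g0: "0 \<le> g" by (rule g) (simp add: band_zero f)
      have h0: "0 \<le> h" by (simp add: h_def g_def del: diff_inf_eq_sup)
      have hf: "h \<le> f" using g0 by (simp add: h_def)
      have h: "h \<in> Rep_band (- (- A))" by (rule band_solid[OF f(1)]) (simp add: h0 hf f(2))
      have "lat_disjoint h a" if a: "a \<in> Rep_band A" for a
      proof -
        define b where "b = inf \<bar>h\<bar> \<bar>a\<bar>"
        have b0: "0 \<le> b" by (simp add: b_def)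
        have bA: "b \<in> Rep_band A" by (rule band_solid[OF a]) (use b0 in \<open>simp add: b_def\<close>)
        have bh: "b \<le> h" using h0 by (simp add: b_def)
        have "real n *\<^sub>R b \<in> ?S" for n
        proof (induction n)
          case 0
          show ?case by (simp add: band_zero f)
        next
          case (Suc n)
          have "real (Suc n) *\<^sub>R b = real n *\<^sub>R b + b" by (simp add: scaleR_left_distrib)
          also have "\<dots> \<le> g + h" by (intro add_mono g[OF Suc] bh)
          finally have "real (Suc n) *\<^sub>R b \<le> f" by (simp add: h_def)
          moreover have "real (Suc n) *\<^sub>R b \<in> Rep_band A" by (rule subspace_scale[OF band_subspace bA])
          moreover have "0 \<le> real (Suc n) *\<^sub>R b" using b0 by (intro scaleR_nonneg_nonneg) auto
          ultimately show ?case by blast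
        qed
        then have "b = 0" by (intro archimedean[OF b0, of f]) blast
        then show ?thesis by (simp add: lat_disjoint_def b_def)
      qed
      then have "h \<in> Rep_band (- A)" by (simp add: in_uminus_band)
      then have "lat_disjoint h h" using h by (simp add: in_uminus_band[of _ "- A"])
      then have "f = g" by (simp add: disjoint_self h_def)
      then show ?thesis by (simp add: g_def le_iff_inf inf_commute)
    qed
    then have "isLub UNIV ?S f" by (auto simp: isLub_UNIV_iff)
    then show ?thesis by (rule band_isLub[rotated]) auto
  qed
  show "- (- A) \<le> A"
    unfolding band_le_iff
  proof (intro allI impI)
    fix f assume "f \<in> Rep_band (- (- A))"
    then have "\<bar>f\<bar> \<in> Rep_band (- (- A))" by (rule band_solid) simp
    then have "\<bar>f\<bar> \<in> Rep_band A" by (rule pos) simp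
    then show "f \<in> Rep_band A" by (rule band_solid) simp
  qed
qed

lemma inf_band_le_iff:
  fixes A B C :: "'a::archimedean_riesz_space band"
  shows "inf A B \<le> C \<longleftrightarrow> B \<le> - inf A (- C)"
proof
  have m1: "inf \<bar>f\<bar> \<bar>g\<bar> \<in> Rep_band X" if "f \<in> Rep_band X" for f g and X :: "'a band"
    by (rule band_solid[OF that]) simp
  have m2: "inf \<bar>f\<bar> \<bar>g\<bar> \<in> Rep_band X" if "g \<in> Rep_band X" for f g and X :: "'a band"
    by (rule band_solid[OF that]) simp
  have dis: "lat_disjoint f g" if "inf \<bar>f\<bar> \<bar>g\<bar> \<in> Rep_band X" "inf \<bar>f\<bar> \<bar>g\<bar> \<in> Rep_band (- X)"
    for f g and X :: "'a band"
    using that disjoint_self[of "inf \<bar>f\<bar> \<bar>g\<bar>"] by (simp add: in_uminus_band) (simp add: lat_disjoint_def)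
  show "B \<le> - inf A (- C)" if *: "inf A B \<le> C"
    unfolding band_le_iff in_uminus_band
  proof (intro allI impI ballI)
    fix f g assume f: "f \<in> Rep_band B" and g: "g \<in> Rep_band (inf A (- C))"
    then have "inf \<bar>f\<bar> \<bar>g\<bar> \<in> Rep_band (inf A B)" by (simp add: in_inf_band m1 m2)
    then have "inf \<bar>f\<bar> \<bar>g\<bar> \<in> Rep_band C" using * by (simp add: band_le_iff)
    moreover have "inf \<bar>f\<bar> \<bar>g\<bar> \<in> Rep_band (- C)" using g by (simp add: in_inf_band m2)
    ultimately show "lat_disjoint f g" by (rule dis)
  qed
  show "inf A B \<le> C" if *: "B \<le> - inf A (- C)"
  proof -
    have "inf A B \<le> - (- C)"
      unfolding band_le_iff in_uminus_band[of _ "- C"]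
    proof (intro allI impI ballI)
      fix f g assume f: "f \<in> Rep_band (inf A B)" and g: "g \<in> Rep_band (- C)"
      have "inf \<bar>f\<bar> \<bar>g\<bar> \<in> Rep_band (inf A (- C))"
        using f g by (simp add: in_inf_band m1 m2)
      moreover have "inf \<bar>f\<bar> \<bar>g\<bar> \<in> Rep_band B" using f by (simp add: in_inf_band m1)
      then have "inf \<bar>f\<bar> \<bar>g\<bar> \<in> Rep_band (- inf A (- C))" using * by (simp only: band_le_iff)
      ultimately show "lat_disjoint f g" by (rule dis)
    qed
    then show ?thesis by (simp add: band_double_compl)
  qed
qed

instance band :: (archimedean_riesz_space) frame
proof
  fix a :: "'a band" and A :: "'a band set"
  have "x \<le> - inf a (- (SUP x\<in>A. inf a x))" if "x \<in> A" for x
    using that by (auto simp: inf_band_le_iff[symmetric] intro: SUP_upper)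
  then have "Sup A \<le> - inf a (- (SUP x\<in>A. inf a x))" by (rule Sup_least)
  then have "inf a (Sup A) \<le> (SUP x\<in>A. inf a x)" by (simp only: inf_band_le_iff)
  then show "inf a (Sup A) = (SUP x\<in>A. inf a x)"
    by (rule antisym) (auto intro!: SUP_least intro: le_infI2 Sup_upper)
qed

instance band :: (archimedean_riesz_space) boolean_algebra
proof
  fix x y z :: "'a band"
  have bot: "inf x (- x) = bot" for x :: "'a band"
  proof (rule antisym[OF _ bot_least])
    show "inf x (- x) \<le> bot"
      unfolding band_le_iff in_inf_band in_bot_band in_uminus_band
      by (auto simp: disjoint_self[symmetric])
  qed
  show "inf x (- x) = bot" by (rule bot)
  show "sup x (inf y z) = inf (sup x y) (sup x z)" by (rule sup_inf_frame)
  show "x - y = inf x (- y)" by (rule minus_band_def)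
  have anti: "- b \<le> - a" if "a \<le> b" for a b :: "'a band"
    using that by (auto simp: band_le_iff in_uminus_band)
  have "- sup x (- x) \<le> inf (- x) (- (- x))" by (intro inf_greatest anti) auto
  then have "- sup x (- x) \<le> bot" by (simp only: bot)
  then have "- bot \<le> - (- sup x (- x))" by (rule anti)
  then have "- bot \<le> sup x (- x)" by (simp only: band_double_compl)
  moreover have "- bot = (top :: 'a band)"
    by (rule antisym) (auto simp: band_le_iff in_uminus_band in_bot_band lat_disjoint_def inf_absorb2 top_band.rep_eq)
  ultimately show "sup x (- x) = top" by (simp only: top_unique)
qed


section \<open>The representation of a Riesz space with weak unit\<close>

definition weak_unit :: "'a::riesz_space \<Rightarrow> bool" where
  "weak_unit e \<longleftrightarrow> 0 < e \<and> generated_band e = top"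

text \<open>\<^term>\<open>spectral_map e f\<close> is \<open>m(f)\<close>, where \<open>e\<close> is the chosen weak unit.\<close>

definition spectral_map ::
    "'a::archimedean_riesz_space \<Rightarrow> 'a \<Rightarrow> 'a band cont_real" where
  "spectral_map e f =
     real_hom (\<lambda>p. SUP r\<in>{p<..}. generated_band (pprt (f - of_rat r *\<^sub>R e)))
              (\<lambda>q. SUP r\<in>{..<q}. - generated_band (pprt (f - of_rat r *\<^sub>R e)))"

lemma in_generated_band: "f \<in> Rep_band (generated_band f)"
  by (simp add: generated_band.rep_eq)

lemma generated_band_le_iff: "generated_band f \<le> A \<longleftrightarrow> f \<in> Rep_band A"
proof
  show "generated_band f \<le> A \<Longrightarrow> f \<in> Rep_band A"
    using in_generated_band[of f] by (simp add: band_le_iff)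
  show "f \<in> Rep_band A \<Longrightarrow> generated_band f \<le> A"
    by transfer blast
qed

lemma disjoint_pprt: "lat_disjoint (pprt (- f)) (pprt f)" for f :: "'a::riesz_space"
proof -
  have n: "inf 0 f = nprt f" by (simp add: nprt_def inf_commute)
  have "pprt f = f + - nprt f"
    using prts[of f] by (metis add_diff_cancel_right' diff_conv_add_uminus)
  then have "inf (pprt (- f)) (pprt f) = inf (0 + - nprt f) (f + - nprt f)"
    by (simp only: pprt_neg add_0_left)
  also have "\<dots> = 0" by (simp only: add_inf_distrib_right[symmetric] n add.right_inverse)
  finally have "inf (pprt (- f)) (pprt f) = 0" .
  then show ?thesis by (simp add: lat_disjoint_def)
qed

lemma disjoint_in_compl:
  fixes f :: "'a::archimedean_riesz_space"
  assumes "lat_disjoint f g"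
  shows "f \<in> Rep_band (- generated_band g)"
proof -
  have "g \<in> Rep_band (- generated_band f)"
  proof -
    have "is_band {x. \<forall>y\<in>{g}. lat_disjoint x y}" by (rule is_band_disjoint)
    then have "Rep_band (generated_band f) \<subseteq> {x. lat_disjoint x g}"
      unfolding generated_band.rep_eq using assms by auto
    then show ?thesis by (auto simp: in_uminus_band intro: disjoint_commute)
  qed
  then have "generated_band g \<le> - generated_band f" by (simp only: generated_band_le_iff)
  then have "generated_band f \<le> - generated_band g" by (rule compl_le_swap1)
  then show ?thesis by (simp only: generated_band_le_iff)
qed

lemma archimedean_le:
  fixes f g :: "'a::archimedean_riesz_space"
  assumes "\<And>n. real n *\<^sub>R f \<le> g"
  shows "f \<le> 0"
proof -
  have "real n *\<^sub>R pprt f \<le> pprt g" for n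
  proof (cases "n = 0")
    case False
    then have "f \<le> pprt g /\<^sub>R real n"
      using assms[of n] by (simp add: pos_le_divideR_eq) (simp add: pprt_def le_supI1)
    moreover have "0 \<le> pprt g /\<^sub>R real n" by (intro scaleR_nonneg_nonneg) auto
    ultimately have "pprt f \<le> pprt g /\<^sub>R real n" by (simp add: pprt_def[of f])
    then show ?thesis using False by (simp add: pos_le_divideR_eq)
  qed simp
  then have "pprt f = 0" by (intro archimedean) auto
  then show ?thesis by (simp add: le_zero_iff_zero_pprt)
qed

lemma weak_unit_cover:
  fixes e f :: "'a::archimedean_riesz_space"
  assumes e: "weak_unit e" and C: "\<And>n. pprt (real n *\<^sub>R e - \<bar>f\<bar>) \<in> Rep_band C"
  shows "C = top"
proof -
  let ?y = "\<lambda>n. pprt (real n *\<^sub>R e - \<bar>f\<bar>) /\<^sub>R real n"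
  have e0: "0 \<le> e" using e by (simp add: weak_unit_def less_imp_le)
  have "?y n \<le> e" for n
  proof (cases "n = 0")
    case False
    have "pprt (real n *\<^sub>R e - \<bar>f\<bar>) \<le> real n *\<^sub>R e"
      using e0 by (simp add: pprt_def scaleR_nonneg_nonneg)
    then show ?thesis using False by (simp add: pos_divideR_le_eq)
  qed (simp add: e0)
  moreover have "e \<le> u" if u: "\<And>n. ?y n \<le> u" for u
  proof -
    have "real n *\<^sub>R (e - u) \<le> \<bar>f\<bar>" for n
    proof (cases "n = 0")
      case False
      then have "pprt (real n *\<^sub>R e - \<bar>f\<bar>) \<le> real n *\<^sub>R u" using u[of n] by (simp add: pos_divideR_le_eq)
      then have "real n *\<^sub>R e - \<bar>f\<bar> \<le> real n *\<^sub>R u" by (simp add: pprt_def)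
      then show ?thesis by (simp add: scaleR_diff_right algebra_simps)
    qed simp
    then have "e - u \<le> 0" by (rule archimedean_le)
    then show ?thesis by simp
  qed
  ultimately have "isLub UNIV (range ?y) e" by (auto simp: isLub_UNIV_iff)
  then have "e \<in> Rep_band C"
    by (rule band_isLub[rotated]) (auto intro: subspace_scale[OF band_subspace C])
  then have "generated_band e \<le> C" by (simp only: generated_band_le_iff)
  then show ?thesis using e by (simp add: weak_unit_def top_unique)
qed

lemma real_assignment_spectral_map:
  fixes e f :: "'a::archimedean_riesz_space"
  assumes e: "weak_unit e"
  shows "real_assignment (\<lambda>p. SUP r\<in>{p<..}. generated_band (pprt (f - of_rat r *\<^sub>R e)))
                         (\<lambda>q. SUP r\<in>{..<q}. - generated_band (pprt (f - of_rat r *\<^sub>R e)))"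
proof -
  define B where "B = (\<lambda>r. generated_band (pprt (f - of_rat r *\<^sub>R e)))"
  have e0: "0 \<le> e" using e by (simp add: weak_unit_def less_imp_le)
  have anti: "B s \<le> B r" if "r \<le> s" for r s
  proof -
    have "of_rat r *\<^sub>R e \<le> of_rat s *\<^sub>R e"
      using that e0 by (intro scaleR_right_mono) (auto simp: of_rat_less_eq)
    then have "pprt (f - of_rat s *\<^sub>R e) \<le> pprt (f - of_rat r *\<^sub>R e)" by (intro pprt_mono) simp
    then show ?thesis
      unfolding B_def generated_band_le_iff by (intro band_solid[OF in_generated_band]) simp
  qed
  have "real_assignment (\<lambda>p. SUP r\<in>{p<..}. B r) (\<lambda>q. SUP r\<in>{..<q}. - B r)"
  proof (rule real_assignmentI)
    fix p q :: rat assume pq: "q \<le> p"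
    show "inf (SUP r\<in>{p<..}. B r) (SUP r\<in>{..<q}. - B r) \<le> bot"
      unfolding SUP_inf_SUP_frame
    proof (intro SUP_least)
      fix r s assume "r \<in> {p<..}" "s \<in> {..<q}"
      then have "B r \<le> B s" using pq by (intro anti) auto
      then have "inf (B r) (- B s) \<le> inf (B s) (- B s)" by (intro inf_mono order_refl)
      then show "inf (B r) (- B s) \<le> bot" by simp
    qed
  next
    fix p q :: rat assume pq: "p < q"
    let ?t = "(p + q) / 2"
    have "top = sup (B ?t) (- B ?t)" by simp
    also have "\<dots> \<le> sup (SUP r\<in>{p<..}. B r) (SUP r\<in>{..<q}. - B r)"
      by (intro sup_mono SUP_upper) (use pq in auto)
    finally show "top \<le> sup (SUP r\<in>{p<..}. B r) (SUP r\<in>{..<q}. - B r)" .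
  next
    fix p
    show "(SUP r\<in>{p<..}. B r) \<le> (SUP q\<in>{p<..}. SUP r\<in>{q<..}. B r)"
    proof (rule SUP_least)
      fix r assume "r \<in> {p<..}"
      then show "B r \<le> (SUP q\<in>{p<..}. SUP r\<in>{q<..}. B r)"
        by (intro SUP_upper2[of "(p + r) / 2"] SUP_upper) auto
    qed
    show "(SUP r\<in>{..<p}. - B r) \<le> (SUP q\<in>{..<p}. SUP r\<in>{..<q}. - B r)"
    proof (rule SUP_least)
      fix r assume "r \<in> {..<p}"
      then show "- B r \<le> (SUP q\<in>{..<p}. SUP r\<in>{..<q}. - B r)"
        by (intro SUP_upper2[of "(p + r) / 2"] SUP_upper) auto
    qed
  next
    let ?C = "SUP p. SUP r\<in>{p<..}. B r"
    have "?C = top"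
    proof (rule weak_unit_cover[OF e])
      fix n
      have "B (- of_nat n) \<le> ?C" by (intro SUP_upper2[of "- of_nat n - 1"] SUP_upper) auto
      then have "pprt (f - of_rat (- of_nat n) *\<^sub>R e) \<in> Rep_band ?C"
        by (simp only: B_def generated_band_le_iff)
      moreover have "pprt (real n *\<^sub>R e - \<bar>f\<bar>) \<le> pprt (f - of_rat (- of_nat n) *\<^sub>R e)"
        using add_left_mono[OF abs_ge_minus_self[of f], of f]
        by (intro pprt_mono) (simp add: of_rat_minus diff_le_eq add.commute add.left_commute minus_le_iff)
      ultimately show "pprt (real n *\<^sub>R e - \<bar>f\<bar>) \<in> Rep_band ?C" by (elim band_solid) simp
    qed
    then show "top \<le> ?C" by simp
  next
    let ?C = "SUP q. SUP r\<in>{..<q}. - B r"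
    have "?C = top"
    proof (rule weak_unit_cover[OF e])
      fix n
      let ?x = "f - of_rat (of_nat n) *\<^sub>R e"
      have "lat_disjoint (pprt (- ?x)) (pprt ?x)" by (rule disjoint_pprt)
      then have "pprt (- ?x) \<in> Rep_band (- B (of_nat n))" unfolding B_def by (rule disjoint_in_compl)
      moreover have "- B (of_nat n) \<le> ?C" by (intro SUP_upper2[of "of_nat n + 1"] SUP_upper) auto
      ultimately have "pprt (- ?x) \<in> Rep_band ?C" by (simp only: band_le_iff)
      moreover have "pprt (real n *\<^sub>R e - \<bar>f\<bar>) \<le> pprt (- ?x)"
        using abs_ge_self[of f] by (intro pprt_mono) simp
      ultimately show "pprt (real n *\<^sub>R e - \<bar>f\<bar>) \<in> Rep_band ?C" by (elim band_solid) simp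
    qed
    then show "top \<le> ?C" by simp
  qed (auto intro!: SUP_subset_mono)
  then show ?thesis unfolding B_def .
qed

lemma gt_val_spectral_map:
    "weak_unit e \<Longrightarrow> gt_val (spectral_map e f) p =
       (SUP r\<in>{p<..}. generated_band (pprt (f - of_rat r *\<^sub>R e)))"
  and lt_val_spectral_map:
    "weak_unit e \<Longrightarrow> lt_val (spectral_map e f) q =
       (SUP r\<in>{..<q}. - generated_band (pprt (f - of_rat r *\<^sub>R e)))"
  unfolding spectral_map_def
  by (simp_all add: gt_val_real_hom lt_val_real_hom real_assignment_spectral_map)


section \<open>Universal completions\<close>

definition universally_complete :: "'a::riesz_space itself \<Rightarrow> bool" where
  "universally_complete _ \<longleftrightarrow>
     (\<forall>S::'a set. S \<noteq> {} \<and> bdd_above S \<longrightarrow> (\<exists>s. isLub UNIV S s)) \<and>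
     (\<forall>S::'a set. S \<noteq> {} \<and> (\<forall>f\<in>S. 0 \<le> f) \<and> pairwise lat_disjoint S \<longrightarrow> (\<exists>s. isLub UNIV S s))"

definition riesz_embedding :: "('a::riesz_space \<Rightarrow> 'b::riesz_space) \<Rightarrow> bool" where
  "riesz_embedding \<mu> \<longleftrightarrow> linear \<mu> \<and> inj \<mu> \<and>
     (\<forall>f g. \<mu> (sup f g) = sup (\<mu> f) (\<mu> g)) \<and> (\<forall>f g. \<mu> (inf f g) = inf (\<mu> f) (\<mu> g))"

definition universal_completion :: "('a::riesz_space \<Rightarrow> 'b::riesz_space) \<Rightarrow> bool" where
  "universal_completion \<mu> \<longleftrightarrow>
     universally_complete TYPE('b) \<and> riesz_embedding \<mu> \<and>
     (\<forall>h\<ge>0. isLub UNIV {\<mu> f | f. 0 \<le> \<mu> f \<and> \<mu> f \<le> h} h)"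

end

theory Submission
  imports Defs
begin

text \<open>Since the bands form a complete Boolean algebra, the right-continuous family
  \<open>p \<mapsto> \<Or>{f(p, -) | f \<in> S}\<close> is a continuous real function as soon as its infimum is bottom; an upper
  bound of \<open>S\<close> forces this, and so does pairwise disjointness.  The map \<open>m\<close> is superadditive because
  \<open>x\<^sup>+ \<and> y\<^sup>+ \<le> (x + y)\<^sup>+\<close>, hence additive because \<open>m(-f) = -m(f)\<close>.  For density, let \<open>k\<close> bound the
  \<open>m(f)\<close> with \<open>0 \<le> m(f) \<le> h\<close>, and let \<open>0 \<le> p < q\<close>.  A positive \<open>y\<close> in the band
  \<open>h(q, -) \<and> k(-, p)\<close> gives the admissible elements \<open>f = ny \<and> qe\<close>, and \<open>m(f) \<le> k\<close> then forces
  \<open>ny \<and> qe \<le> pe\<close> for all \<open>n\<close>, so \<open>y = 0\<close>; hence \<open>h \<le> k\<close>.\<close>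

section \<open>Suprema of continuous real functions on a complete Boolean algebra\<close>

text \<open>The elements \<open>lt_val f q\<close> cover the top, and the infimum meets each of them
  in bottom because it lies below \<open>gt_val f q\<close>. So the condition \<open>bot\<close> of
  \<open>real_assignment_cut\<close> is necessary as well.\<close>

lemma INF_gt_val: "(INF p. gt_val f p) = bot"
proof -
  have "(INF p. gt_val f p) \<le> bot"
  proof (rule frame_cover_SUP[OF SUP_lt[of f]])
    fix q
    have "inf (INF p. gt_val f p) (lt_val f q) \<le> inf (gt_val f q) (lt_val f q)"
      by (intro inf_mono INF_lower UNIV_I order_refl)
    then show "inf (INF p. gt_val f p) (lt_val f q) \<le> bot" by (simp add: gt_lt_bot)
  qed
  then show ?thesis by (simp add: bot_unique)
qed

text \<open>Complements supply the lower half of the cut. Joining \<open>- u r\<close> over r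
  strictly below q makes that half left-continuous, and by De Morgan it covers the top exactly
  because the infimum of \<open>u\<close> is bottom.\<close>

lemma real_assignment_cut:
  fixes u :: "rat \<Rightarrow> 'l::{frame, boolean_algebra}"
  assumes right: "\<And>p. u p = (SUP q\<in>{p<..}. u q)"
    and top: "(SUP p. u p) = top" and bot: "(INF p. u p) = bot"
  shows "real_assignment u (\<lambda>q. SUP r\<in>{..<q}. - u r)"
proof (rule real_assignmentI)
  have anti: "u q \<le> u p" if "p \<le> q" for p q
    using right[of p] that by (cases "p = q") (auto intro!: SUP_upper)
  show "inf (u p) (SUP r\<in>{..<q}. - u r) \<le> bot" if "q \<le> p" for p q
    unfolding inf_SUP_frame
  proof (rule SUP_least)
    fix r assume "r \<in> {..<q}"
    then have "inf (u p) (- u r) \<le> inf (u r) (- u r)"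
      using that by (intro inf_mono anti) auto
    then show "inf (u p) (- u r) \<le> bot" by simp
  qed
  show "top \<le> sup (u p) (SUP r\<in>{..<q}. - u r)" if "p < q" for p q
  proof -
    have "sup (u p) (- u p) \<le> sup (u p) (SUP r\<in>{..<q}. - u r)"
      using that by (intro sup_mono order_refl SUP_upper) auto
    then show ?thesis by simp
  qed
  show "u q \<le> u p" if "p < q" for p q using that by (intro anti) simp
  show "u p \<le> (SUP q\<in>{p<..}. u q)" for p using right[of p] by simp
  show "(SUP r\<in>{..<q}. - u r) \<le> (SUP r\<in>{..<p}. - u r)" if "q < p" for p q
    using that by (intro SUP_subset_mono) auto
  show "(SUP r\<in>{..<p}. - u r) \<le> (SUP q\<in>{..<p}. SUP r\<in>{..<q}. - u r)" for p
  proof (rule SUP_least)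
    fix r assume "r \<in> {..<p}"
    then show "- u r \<le> (SUP q\<in>{..<p}. SUP r\<in>{..<q}. - u r)"
      by (intro SUP_upper2[of "(r + p) / 2"] SUP_upper) auto
  qed
  show "top \<le> (SUP p. u p)" by (simp add: top)
  let ?C = "SUP q. SUP r\<in>{..<q}. - u r"
  have "- u r \<le> ?C" for r
    by (intro SUP_upper2[of "r + 1"] SUP_upper) auto
  then have "- ?C \<le> (INF p. u p)" by (intro INF_greatest) (rule compl_le_swap2)
  then have "- ?C = bot" by (simp add: bot bot_unique)
  then have "?C = top" by (metis compl_bot_eq double_compl)
  then show "top \<le> ?C" by simp
qed

text \<open>Right continuity and covering pass to pointwise joins, since joins commute; only the
  infimum condition can fail. The order compares values of \<open>gt_val\<close> alone, so the
  pointwise join is the least upper bound.\<close>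

lemma isLub_cont_real:
  fixes S :: "'l::{frame, boolean_algebra} cont_real set"
  assumes ne: "S \<noteq> {}" and bot: "(INF p. SUP f\<in>S. gt_val f p) = bot"
  shows "\<exists>s. isLub UNIV S s"
proof -
  let ?u = "\<lambda>p. SUP f\<in>S. gt_val f p"
  have "?u p = (SUP q\<in>{p<..}. ?u q)" for p
    by (subst SUP_commute) (simp add: gt_SUP[of _ p, symmetric])
  moreover have "(SUP p. ?u p) = top"
    by (subst SUP_commute) (simp add: SUP_gt ne)
  ultimately have ra: "real_assignment ?u (\<lambda>q. SUP r\<in>{..<q}. - ?u r)"
    using bot by (intro real_assignment_cut)
  have "isLub UNIV S (real_hom ?u (\<lambda>q. SUP r\<in>{..<q}. - ?u r))"
    unfolding isLub_UNIV_iff less_eq_cont_real_def gt_val_real_hom[OF ra]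
    by (auto intro: SUP_upper SUP_least)
  then show ?thesis ..
qed

text \<open>Both halves reduce to the infimum condition. For a bounded set the infimum lies below
  that of the bound. For a disjoint set, on \<open>gt_val f 0\<close> every other member vanishes,
  so there the infimum is that of \<open>f\<close> alone; and the whole infimum lies below the join
  of these supports.\<close>

lemma universally_complete_cont_real:
  "universally_complete TYPE('l::{frame, boolean_algebra} cont_real)"
  unfolding universally_complete_def
proof (intro conjI allI impI; elim conjE)
  fix S :: "'l cont_real set" assume ne: "S \<noteq> {}"
  {
    assume "bdd_above S"
    then obtain g where g: "\<And>f. f \<in> S \<Longrightarrow> f \<le> g" by (auto simp: bdd_above_def)
    have "(INF p. SUP f\<in>S. gt_val f p) \<le> (INF p. gt_val g p)"
      by (intro INF_mono' SUP_least gt_val_mono g)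
    then show "\<exists>s. isLub UNIV S s" by (intro isLub_cont_real ne) (simp add: INF_gt_val bot_unique)
  }
  assume pos: "\<forall>f\<in>S. 0 \<le> f" and dis: "pairwise lat_disjoint S"
  let ?b = "INF p. SUP f\<in>S. gt_val f p"
  have 1: "inf (gt_val g 0) (gt_val f 0) = bot" if "f \<in> S" "g \<in> S" "f \<noteq> g" for f g
  proof -
    have "inf g f = 0"
      using pairwiseD[OF dis, of g f] pos that by (auto simp: lat_disjoint_def)
    then show ?thesis using gt_val_inf[of g f 0] by (simp add: gt_val_zero)
  qed
  have "inf ?b (gt_val f 0) \<le> bot" if f: "f \<in> S" for f
    unfolding INF_gt_val[of f, symmetric]
  proof (rule INF_greatest)
    fix p
    \<comment> \<open>At a negative level every positive g has value top. Moving up to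
      \<open>max p 0\<close> puts g inside its support, where disjointness applies.\<close>
    have "inf ?b (gt_val f 0) \<le> inf (SUP g\<in>S. gt_val g (max p 0)) (gt_val f 0)"
      by (intro inf_mono INF_lower order_refl) simp
    also have "\<dots> \<le> gt_val f p"
      unfolding SUP_inf_frame
    proof (rule SUP_least)
      fix g assume g: "g \<in> S"
      show "inf (gt_val g (max p 0)) (gt_val f 0) \<le> gt_val f p"
      proof (cases "f = g")
        case True
        then show ?thesis by (intro le_infI1) (simp add: gt_mono)
      next
        case False
        have "inf (gt_val g (max p 0)) (gt_val f 0) \<le> inf (gt_val g 0) (gt_val f 0)"
          by (intro inf_mono order_refl gt_mono) simp
        then show ?thesis using 1[OF f g False] by (simp add: bot_unique)
      qed
    qed
    finally show "inf ?b (gt_val f 0) \<le> gt_val f p" .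
  qed
  then have "inf ?b (SUP f\<in>S. gt_val f 0) \<le> bot"
    unfolding inf_SUP_frame by (rule SUP_least)
  moreover have "?b \<le> (SUP f\<in>S. gt_val f 0)" by (rule INF_lower) simp
  ultimately have "?b = bot" by (simp add: inf_absorb1 bot_unique)
  then show "\<exists>s. isLub UNIV S s" by (rule isLub_cont_real[OF ne])
qed

section \<open>Principal bands\<close>

lemma generated_band_mono:
  "0 \<le> x \<Longrightarrow> x \<le> y \<Longrightarrow> generated_band x \<le> generated_band y"
  for x y :: "'a::archimedean_riesz_space"
  unfolding generated_band_le_iff by (rule band_solid[OF in_generated_band]) simp

text \<open>The join of the two bands contains \<open>x + y\<close>, which dominates
  \<open>sup x y\<close>; solidity gives the nontrivial inclusion.\<close>

lemma generated_band_sup: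
  fixes x y :: "'a::archimedean_riesz_space"
  assumes "0 \<le> x" "0 \<le> y"
  shows "generated_band (sup x y) = sup (generated_band x) (generated_band y)"
proof (rule antisym)
  let ?B = "sup (generated_band x) (generated_band y)"
  have "generated_band x \<le> ?B" "generated_band y \<le> ?B" by simp_all
  then have "x + y \<in> Rep_band ?B"
    by (intro subspace_add[OF band_subspace]) (simp_all only: generated_band_le_iff)
  then show "generated_band (sup x y) \<le> ?B"
    unfolding generated_band_le_iff
    by (rule band_solid) (use assms in \<open>auto simp: le_supI1 add_increasing add_increasing2\<close>)
  show "?B \<le> generated_band (sup x y)"
    using assms by (intro sup_least generated_band_mono) auto
qed

text \<open>If z lies in the band of \<open>y\<close> and is disjoint from \<open>inf x y\<close>,
  then \<open>inf \<bar>z\<bar> x\<close> is both in that band and disjoint from \<open>y\<close>,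
  hence zero, so z is disjoint from \<open>x\<close>. Thus the complement of the right side meets
  the left side in bottom.\<close>

lemma inf_generated_band_le:
  fixes x y :: "'a::archimedean_riesz_space"
  assumes "0 \<le> x" "0 \<le> y"
  shows "inf (generated_band x) (generated_band y) \<le> generated_band (inf x y)"
proof -
  let ?C = "- generated_band (inf x y)"
  have *: "inf ?C (generated_band y) \<le> - generated_band x"
    unfolding band_le_iff
  proof (intro allI impI)
    fix z assume z: "z \<in> Rep_band (inf ?C (generated_band y))"
    have "lat_disjoint z (inf x y)"
      using z in_generated_band[of "inf x y"] by (auto simp: in_inf_band in_uminus_band)
    then have "lat_disjoint (inf \<bar>z\<bar> x) y"
      using assms by (simp add: lat_disjoint_def inf_assoc)
    then have "inf \<bar>z\<bar> x \<in> Rep_band (- generated_band y)" by (rule disjoint_in_compl)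
    moreover have "inf \<bar>z\<bar> x \<in> Rep_band (generated_band y)"
      by (rule band_solid[of z]) (use z assms in \<open>auto simp: in_inf_band\<close>)
    ultimately have "inf \<bar>z\<bar> x = 0"
      by (simp add: in_uminus_band disjoint_self[symmetric])
    then show "z \<in> Rep_band (- generated_band x)"
      using assms by (intro disjoint_in_compl) (simp add: lat_disjoint_def)
  qed
  have "inf (inf (generated_band x) (generated_band y)) ?C \<le> inf (generated_band x) (inf ?C (generated_band y))"
    by (simp add: inf_aci)
  also have "\<dots> \<le> inf (generated_band x) (- generated_band x)"
    by (intro inf_mono * order_refl)
  finally show ?thesis by (simp add: inf_shunt bot_unique)
qed

section \<open>The spectral map is a Riesz embedding\<close>

text \<open>As \<open>x = pprt x + nprt x\<close> and \<open>nprt\<close> is monotone, adding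
  \<open>nprt (inf x y)\<close> to the infimum of the positive parts gives something below both
  \<open>x\<close> and \<open>y\<close>; cancelling it again gives the hard inequality.\<close>

lemma pprt_inf: "pprt (inf x y) = inf (pprt x) (pprt y)" for x y :: "'a::riesz_space"
proof (rule antisym)
  let ?m = "inf (pprt x) (pprt y)" and ?n = "nprt (inf x y)"
  have "?m \<le> x - nprt x" using prts[of x] by (metis inf_le1 add_diff_cancel_right')
  then have "?m + nprt x \<le> x" by (simp only: le_diff_eq)
  moreover have "?m + ?n \<le> ?m + nprt x" by (intro add_left_mono) (simp add: nprt_mono)
  ultimately have x: "?m + ?n \<le> x" by (rule order_trans[rotated])
  have "?m \<le> y - nprt y" using prts[of y] by (metis inf_le2 add_diff_cancel_right')
  then have "?m + nprt y \<le> y" by (simp only: le_diff_eq)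
  moreover have "?m + ?n \<le> ?m + nprt y" by (intro add_left_mono) (simp add: nprt_mono)
  ultimately have y: "?m + ?n \<le> y" by (rule order_trans[rotated])
  have "?m + ?n \<le> inf x y" using x y by (rule inf_greatest)
  also have "\<dots> = pprt (inf x y) + ?n" by (rule prts)
  finally show "?m \<le> pprt (inf x y)" by (simp only: add_le_cancel_right)
qed simp

text \<open>Twice \<open>inf x y\<close> is at most \<open>x + y\<close>, so \<open>inf x y\<close>
  is at most half of \<open>pprt (x + y)\<close>.\<close>

lemma inf_pprt_le: "inf (pprt x) (pprt y) \<le> pprt (x + y)" for x y :: "'a::riesz_space"
proof -
  let ?z = "inf x y"
  have "inf (pprt x) (pprt y) = pprt ?z"
    by (rule pprt_inf[symmetric])
  also have "\<dots> \<le> pprt (x + y)"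
  proof -
    have "?z + ?z \<le> x + y" by (intro add_mono) auto
    then have "(1/2) *\<^sub>R (?z + ?z) \<le> (1/2) *\<^sub>R pprt (x + y)"
      by (intro scaleR_left_mono) (auto simp: pprt_def le_supI1)
    also have "\<dots> \<le> 1 *\<^sub>R pprt (x + y)" by (intro scaleR_right_mono) auto
    finally show ?thesis by (simp add: pprt_def[of ?z] scaleR_2[symmetric])
  qed
  finally show ?thesis .
qed

section \<open>The spectral map of a fixed weak unit: values, algebra, injectivity\<close>

context
  fixes e :: "'a::archimedean_riesz_space"
  assumes e: "weak_unit e"
begin

lemma weak_unit_nonneg: "0 \<le> e"
  using e by (simp add: weak_unit_def less_imp_le)

lemma in_band_weak_unit: "e \<in> Rep_band C \<Longrightarrow> C = top"
  using e by (simp add: weak_unit_def generated_band_le_iff[symmetric] top_unique)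

text \<open>The join over r > p is redundant: the positive parts at the levels p + 1/(n+1) have
  supremum the one at p, and bands are closed under suprema. For an upper bound u, n(f - p e - u) <=
  e for all n, so the Archimedean property applies.\<close>

lemma gt_val_spectral_map_eq:
  "gt_val (spectral_map e f) p = generated_band (pprt (f - of_rat p *\<^sub>R e))"
proof (rule antisym)
  let ?y = "f - of_rat p *\<^sub>R e" and ?x = "\<lambda>n. pprt (f - of_rat (p + 1 / of_nat (Suc n)) *\<^sub>R e)"
  show "gt_val (spectral_map e f) p \<le> generated_band (pprt ?y)"
    unfolding gt_val_spectral_map[OF e]
    by (intro SUP_least generated_band_mono zero_le_pprt pprt_mono diff_left_mono scaleR_right_mono
        weak_unit_nonneg) (simp add: of_rat_less_eq)
  let ?C = "gt_val (spectral_map e f) p"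
  have x: "?x n = pprt (?y - (1 / real (Suc n)) *\<^sub>R e)" for n
    by (simp only: of_rat_add of_rat_divide of_rat_1 of_rat_of_nat_eq scaleR_left_distrib diff_diff_eq)
  have "isLub UNIV (range ?x) (pprt ?y)"
    unfolding isLub_UNIV_iff
  proof (intro conjI allI impI ballI)
    fix z assume "z \<in> range ?x"
    moreover have "?x n \<le> pprt ?y" for n
      unfolding x by (intro pprt_mono) (simp add: weak_unit_nonneg scaleR_nonneg_nonneg)
    ultimately show "z \<le> pprt ?y" by blast
  next
    fix u assume u: "\<forall>z\<in>range ?x. z \<le> u"
    have le: "pprt (?y - (1 / real (Suc n)) *\<^sub>R e) \<le> u" for n
      using u unfolding x by blast
    have "real n *\<^sub>R (?y - u) \<le> e" for n
    proof (cases n)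
      case (Suc k)
      have "?y - u \<le> (1 / real n) *\<^sub>R e"
        using order_trans[OF sup_ge1 le[of k, unfolded pprt_def]] Suc by (simp add: algebra_simps)
      then have "real n *\<^sub>R (?y - u) \<le> real n *\<^sub>R ((1 / real n) *\<^sub>R e)"
        by (intro scaleR_left_mono) auto
      then show ?thesis using Suc by simp
    qed (simp add: weak_unit_nonneg)
    then have "?y - u \<le> 0" by (rule archimedean_le)
    moreover have "0 \<le> u" using zero_le_pprt le[of 0] by (rule order_trans)
    ultimately show "pprt ?y \<le> u" by (simp add: pprt_def)
  qed
  moreover have "?x n \<in> Rep_band ?C" for n
    unfolding generated_band_le_iff[symmetric] gt_val_spectral_map[OF e] by (rule SUP_upper) simp
  ultimately show "generated_band (pprt ?y) \<le> ?C"
    unfolding generated_band_le_iff by (intro band_isLub[of "range ?x"]) auto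
qed

text \<open>One inequality is the disjointness of the positive parts of z and -z. For the other, if
  r < -p then (f - r e) + (-f - p e) is a positive multiple of \<open>e\<close>, so the two bands
  join to the top and the complement of the first lies in the second.\<close>

lemma spectral_map_uminus: "spectral_map e (- f) = - spectral_map e f"
proof (rule cont_real_gt_eqI, rule antisym)
  let ?G = "\<lambda>f r. generated_band (pprt (f - of_rat r *\<^sub>R e))"
  fix p
  have neg: "- f - of_rat r *\<^sub>R e = - (f - of_rat (- r) *\<^sub>R e)" for r
    by (simp add: of_rat_minus)
  have "?G (- f) r \<le> - ?G f (- r)" for r
    unfolding generated_band_le_iff neg by (intro disjoint_in_compl disjoint_pprt)
  moreover have "- ?G f (- r) \<le> (SUP r\<in>{..<- p}. - ?G f r)" if "p < r" for r
    by (rule SUP_upper) (use that in simp)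
  ultimately have "?G (- f) r \<le> (SUP r\<in>{..<- p}. - ?G f r)" if "p < r" for r
    using that order_trans by blast
  then show "gt_val (spectral_map e (- f)) p \<le> gt_val (- spectral_map e f) p"
    unfolding gt_val_spectral_map[OF e] gt_val_uminus lt_val_spectral_map[OF e] by (rule SUP_least) simp
  have "- ?G f r \<le> ?G (- f) p" if "r < - p" for r
  proof -
    let ?B = "sup (?G f r) (?G (- f) p)"
    let ?d = "of_rat (- p - r) :: real"
    have d: "0 < ?d" using that by (simp only: zero_less_of_rat_iff)
    have "?d *\<^sub>R e = (f - of_rat r *\<^sub>R e) + (- f - of_rat p *\<^sub>R e)"
      by (simp only: of_rat_diff of_rat_minus scaleR_left_diff_distrib scaleR_minus_left) simp
    also have "\<dots> \<le> pprt (f - of_rat r *\<^sub>R e) + pprt (- f - of_rat p *\<^sub>R e)"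
      by (intro add_mono) (simp_all add: pprt_def)
    finally have le: "?d *\<^sub>R e \<le> pprt (f - of_rat r *\<^sub>R e) + pprt (- f - of_rat p *\<^sub>R e)" (is "_ \<le> ?w") .
    have "?G f r \<le> ?B" "?G (- f) p \<le> ?B" by simp_all
    then have w: "?w \<in> Rep_band ?B"
      by (intro subspace_add[OF band_subspace]) (simp_all only: generated_band_le_iff)
    have "0 \<le> ?d *\<^sub>R e" using d weak_unit_nonneg by (intro scaleR_nonneg_nonneg) auto
    then have "?d *\<^sub>R e \<in> Rep_band ?B" by (intro band_solid[OF w]) (use le in auto)
    then have "(1 / ?d) *\<^sub>R ?d *\<^sub>R e \<in> Rep_band ?B" by (rule subspace_scale[OF band_subspace])
    then have "?B = top" using d by (intro in_band_weak_unit) simp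
    then show ?thesis by (metis sup_shunt double_compl)
  qed
  then show "gt_val (- spectral_map e f) p \<le> gt_val (spectral_map e (- f)) p"
    unfolding gt_val_spectral_map_eq gt_val_uminus lt_val_spectral_map[OF e] by (rule SUP_least) simp
qed

lemma spectral_map_add: "spectral_map e (f + g) = spectral_map e f + spectral_map e g"
proof -
  have le: "spectral_map e f + spectral_map e g \<le> spectral_map e (f + g)" for f g
  proof (intro cont_real_leI gt_plus_leI')
    fix p r s :: rat assume p: "r + s = p"
    let ?x = "f - of_rat r *\<^sub>R e" and ?y = "g - of_rat s *\<^sub>R e"
    have "inf (generated_band (pprt ?x)) (generated_band (pprt ?y)) \<le> generated_band (inf (pprt ?x) (pprt ?y))"
      by (intro inf_generated_band_le) auto
    also have "\<dots> \<le> generated_band (pprt (?x + ?y))"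
      by (intro generated_band_mono inf_pprt_le) auto
    also have "?x + ?y = f + g - of_rat p *\<^sub>R e"
      by (simp add: p[symmetric] of_rat_add scaleR_left_distrib)
    finally show "inf (gt_val (spectral_map e f) r) (gt_val (spectral_map e g) s)
        \<le> gt_val (spectral_map e (f + g)) p"
      by (simp only: gt_val_spectral_map_eq)
  qed
  have "- spectral_map e f + - spectral_map e g \<le> - spectral_map e (f + g)"
    using le[of "- f" "- g"] by (simp add: spectral_map_uminus[symmetric] add.commute)
  then have "spectral_map e (f + g) \<le> spectral_map e f + spectral_map e g"
    using neg_le_iff_le[of "spectral_map e f + spectral_map e g"] by (simp add: add.commute)
  then show ?thesis using le by (rule antisym)
qed

lemma spectral_map_sup: "spectral_map e (sup f g) = sup (spectral_map e f) (spectral_map e g)"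
proof (rule cont_real_gt_eqI)
  fix p
  have "pprt (sup f g - of_rat p *\<^sub>R e) = sup (pprt (f - of_rat p *\<^sub>R e)) (pprt (g - of_rat p *\<^sub>R e))"
    using add_sup_distrib_right[of f g "- (of_rat p *\<^sub>R e)"] by (simp add: pprt_def sup_aci)
  then show "gt_val (spectral_map e (sup f g)) p = gt_val (sup (spectral_map e f) (spectral_map e g)) p"
    by (simp add: gt_val_spectral_map_eq gt_val_sup generated_band_sup)
qed

lemma spectral_map_inf: "spectral_map e (inf f g) = inf (spectral_map e f) (spectral_map e g)"
  unfolding inf_eq_neg_sup spectral_map_uminus spectral_map_sup ..

lemma spectral_map_nonneg: "0 \<le> f \<Longrightarrow> 0 \<le> spectral_map e f"
  using spectral_map_sup[of 0 f] spectral_map_add[of 0 0]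
  by (metis add_cancel_right_left le_iff_sup)

text \<open>For c > 0 and p < c r, c(f - r e) <= c f - p e, and bands ignore positive factors; this
  gives one inequality. Applying it to 1/c and c f gives the reverse. Negative c reduces to
  negation.\<close>

lemma spectral_map_scaleR: "spectral_map e (c *\<^sub>R f) = c *\<^sub>R spectral_map e f"
proof -
  have le: "c *\<^sub>R spectral_map e f \<le> spectral_map e (c *\<^sub>R f)" if c: "0 < c" for c f
  proof (rule cont_real_leI)
    fix p
    have "generated_band (pprt (f - of_rat r *\<^sub>R e)) \<le> generated_band (pprt (c *\<^sub>R f - of_rat p *\<^sub>R e))"
      if r: "of_rat p < c * of_rat r" for r
    proof -
      have "c *\<^sub>R f - (c * of_rat r) *\<^sub>R e \<le> c *\<^sub>R f - of_rat p *\<^sub>R e"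
        using r by (intro diff_left_mono scaleR_right_mono weak_unit_nonneg) simp
      also have "\<dots> \<le> pprt (c *\<^sub>R f - of_rat p *\<^sub>R e)" by (simp add: pprt_def)
      finally have "c *\<^sub>R (f - of_rat r *\<^sub>R e) \<le> pprt (c *\<^sub>R f - of_rat p *\<^sub>R e)"
        by (simp add: scaleR_diff_right)
      then have "f - of_rat r *\<^sub>R e \<le> pprt (c *\<^sub>R f - of_rat p *\<^sub>R e) /\<^sub>R c"
        using c by (simp add: pos_le_divideR_eq)
      moreover have "0 \<le> pprt (c *\<^sub>R f - of_rat p *\<^sub>R e) /\<^sub>R c"
        using c by (intro scaleR_nonneg_nonneg) auto
      ultimately have *: "pprt (f - of_rat r *\<^sub>R e) \<le> pprt (c *\<^sub>R f - of_rat p *\<^sub>R e) /\<^sub>R c"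
        by (simp add: pprt_def[of "f - _"])
      show ?thesis
        unfolding generated_band_le_iff
        by (rule band_solid[OF subspace_scale[OF band_subspace in_generated_band, of "inverse c"]])
          (use * order_trans[OF zero_le_pprt *] in simp)
    qed
    then show "gt_val (c *\<^sub>R spectral_map e f) p \<le> gt_val (spectral_map e (c *\<^sub>R f)) p"
      using c by (simp add: scaleR_cont_real_def gt_val_scale gt_val_spectral_map_eq SUP_le_iff)
  qed
  have pos: "spectral_map e (c *\<^sub>R f) = c *\<^sub>R spectral_map e f" if c: "0 < c" for c f
  proof (rule antisym)
    have "c *\<^sub>R (1 / c) *\<^sub>R spectral_map e (c *\<^sub>R f) \<le> c *\<^sub>R spectral_map e ((1 / c) *\<^sub>R c *\<^sub>R f)"
      using c by (intro scaleR_left_mono le) auto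
    then show "spectral_map e (c *\<^sub>R f) \<le> c *\<^sub>R spectral_map e f" using c by simp
  qed (rule le[OF c])
  consider "0 < c" | "c = 0" | "0 < - c" by linarith
  then show ?thesis
  proof cases
    case 2
    then show ?thesis using spectral_map_add[of 0 0] by simp
  next
    case 3
    from pos[OF this, of "- f"] show ?thesis by (simp add: spectral_map_uminus)
  qed (rule pos)
qed

lemma riesz_embedding_spectral_map: "riesz_embedding (spectral_map e)"
  unfolding riesz_embedding_def
proof (intro conjI allI spectral_map_sup spectral_map_inf)
  show lin: "linear (spectral_map e)"
    by (rule linearI) (simp_all add: spectral_map_add spectral_map_scaleR)
  have "f = 0" if "spectral_map e f = 0" for f
  proof -
    \<comment> \<open>The value at level 0 is the band of \<open>pprt g\<close>, so kernel elements
      are at most 0; this is then used for both \<open>f\<close> and \<open>- f\<close>.\<close>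
    have *: "g \<le> 0" if "spectral_map e g = 0" for g
    proof -
      have "generated_band (pprt g) = bot"
        using gt_val_spectral_map_eq[of g 0] that by (simp add: gt_val_zero)
      then show ?thesis using in_generated_band[of "pprt g"]
        by (simp add: in_bot_band le_zero_iff_zero_pprt)
    qed
    have "- f \<le> 0" by (rule *) (simp add: that spectral_map_uminus)
    then have "0 \<le> f" by simp
    with *[OF that] show ?thesis by (rule antisym)
  qed
  then show "inj (spectral_map e)" by (simp add: linear_injective_0[OF lin])
qed

section \<open>Density of the image\<close>

lemma weak_unit_disjoint: "lat_disjoint f e \<Longrightarrow> f = 0"
  using disjoint_in_compl[of f e] e
  by (simp add: weak_unit_def in_uminus_band top_band.rep_eq disjoint_self[symmetric])

text \<open>Subtracting \<open>p *\<^sub>R e\<close> shows that the positive part of n y - p e is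
  disjoint from (q - p) e, a strictly positive multiple of the weak unit, and so vanishes. Hence n y
  <= p e for all n.\<close>

lemma scaled_truncations_bounded_imp_zero:
  assumes y: "0 \<le> y" and pq: "0 \<le> p" "p < q" and le: "\<And>n. inf (real n *\<^sub>R y) (q *\<^sub>R e) \<le> p *\<^sub>R e"
  shows "y = 0"
proof (rule archimedean[OF y])
  fix n
  let ?x = "pprt (real n *\<^sub>R y - p *\<^sub>R e)"
  have "inf (real n *\<^sub>R y - p *\<^sub>R e) ((q - p) *\<^sub>R e) = inf (real n *\<^sub>R y) (q *\<^sub>R e) - p *\<^sub>R e"
    using add_inf_distrib_right[of "real n *\<^sub>R y" "q *\<^sub>R e" "- (p *\<^sub>R e)"]
    by (simp add: scaleR_left_diff_distrib)
  also have "\<dots> \<le> 0" using le[of n] by simp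
  finally have "pprt (inf (real n *\<^sub>R y - p *\<^sub>R e) ((q - p) *\<^sub>R e)) = 0" by simp
  moreover have d: "0 \<le> (q - p) *\<^sub>R e" using pq weak_unit_nonneg by (intro scaleR_nonneg_nonneg) auto
  ultimately have "inf ?x ((q - p) *\<^sub>R e) \<le> 0"
    by (simp add: pprt_inf)
  then have "lat_disjoint ((q - p) *\<^sub>R e) ?x" using d by (intro disjointI) (simp add: inf_commute)
  then have "lat_disjoint ((1 / (q - p)) *\<^sub>R (q - p) *\<^sub>R e) ?x" by (rule disjoint_scaleR)
  then have "?x = 0" using pq by (intro weak_unit_disjoint) (simp add: disjoint_commute)
  then show "real n *\<^sub>R y \<le> p *\<^sub>R e" by (simp add: le_zero_iff_zero_pprt[symmetric])
qed

lemma isLub_spectral_map: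
  assumes h: "0 \<le> h"
  shows "isLub UNIV {spectral_map e f | f. 0 \<le> spectral_map e f \<and> spectral_map e f \<le> h} h"
  unfolding isLub_UNIV_iff
proof (intro conjI allI impI ballI)
  fix k assume "\<forall>g\<in>{spectral_map e f | f. 0 \<le> spectral_map e f \<and> spectral_map e f \<le> h}. g \<le> k"
  then have k: "spectral_map e f \<le> k" if "0 \<le> f" "spectral_map e f \<le> h" for f
    using that spectral_map_nonneg by blast
  have "spectral_map e 0 = 0" using spectral_map_add[of 0 0] by simp
  then have k0: "0 \<le> k" using k[of 0] h by simp
  \<comment> \<open>A nonzero meet would be a region where h exceeds q while k stays below p;
    truncated multiples of an element there would be admissible but not below k.\<close>
  have key: "inf (gt_val h q) (lt_val k p) = bot" if pq: "0 \<le> p" "p < q" for p q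
  proof -
    let ?b = "inf (gt_val h q) (lt_val k p)"
    have nonneg: "y = 0" if y: "y \<in> Rep_band ?b" "0 \<le> y" for y
    proof (rule scaled_truncations_bounded_imp_zero[of y "of_rat p" "of_rat q"])
      show "0 \<le> y" "0 \<le> (of_rat p :: real)" "(of_rat p :: real) < of_rat q"
        using y pq by (simp_all add: of_rat_less)
      fix n
      let ?f = "inf (real n *\<^sub>R y) (of_rat q *\<^sub>R e)"
      have f0: "0 \<le> ?f"
        using y pq weak_unit_nonneg by (simp add: scaleR_nonneg_nonneg)
      have fb: "generated_band (pprt (?f - of_rat r *\<^sub>R e)) \<le> ?b" if "0 \<le> r" for r
      proof -
        have "0 \<le> of_rat r *\<^sub>R e"
          using that weak_unit_nonneg by (intro scaleR_nonneg_nonneg) auto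
        then have "pprt (?f - of_rat r *\<^sub>R e) \<le> pprt ?f"
          by (intro pprt_mono) (simp only: diff_le_eq le_add_same_cancel1)
        also have "\<dots> = ?f" using f0 by (rule pprt_eq_id)
        also have "\<dots> \<le> real n *\<^sub>R y" by (rule inf_le1)
        also have "\<dots> \<le> \<bar>real n *\<^sub>R y\<bar>" by (rule abs_ge_self)
        finally have "\<bar>pprt (?f - of_rat r *\<^sub>R e)\<bar> \<le> \<bar>real n *\<^sub>R y\<bar>"
          by (simp only: abs_of_nonneg zero_le_pprt)
        then show ?thesis
          unfolding generated_band_le_iff
          by (rule band_solid[OF subspace_scale[OF band_subspace y(1)]])
      qed
      \<comment> \<open>Below level 0, h has value top; from q on, the truncation at q e makes the
        left side bottom; in between, \<open>fb\<close> puts it below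
        \<open>gt_val h q\<close>.\<close>
      have "spectral_map e ?f \<le> h"
      proof (rule cont_real_leI)
        fix r
        consider "r < 0" | "q \<le> r" | "0 \<le> r" "r < q" by linarith
        then show "gt_val (spectral_map e ?f) r \<le> gt_val h r"
        proof cases
          case 1
          then show ?thesis using gt_val_mono[OF h, of r] by (simp add: gt_val_zero top_unique)
        next
          case 2
          then have "of_rat q *\<^sub>R e \<le> of_rat r *\<^sub>R e"
            by (intro scaleR_right_mono weak_unit_nonneg) (simp add: of_rat_less_eq)
          then have "pprt (?f - of_rat r *\<^sub>R e) = 0"
            by (simp add: le_zero_iff_zero_pprt[symmetric] le_infI2)
          then show ?thesis
            by (simp add: gt_val_spectral_map_eq generated_band_le_iff band_zero)
        next
          case 3
          then show ?thesis
            unfolding gt_val_spectral_map_eq using fb[of r] gt_mono[of r q h]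
            by (meson inf_le1 less_imp_le order_trans)
        qed
      qed
      then have "gt_val (spectral_map e ?f) p \<le> gt_val k p" by (intro gt_val_mono k f0)
      \<comment> \<open>Admissibility puts this band in \<open>gt_val k p\<close>, while
        \<open>fb\<close> keeps it in \<open>lt_val k p\<close>; the two are disjoint.\<close>
      then have "generated_band (pprt (?f - of_rat p *\<^sub>R e)) \<le> inf (gt_val k p) (lt_val k p)"
        using fb[OF pq(1)] by (simp add: gt_val_spectral_map_eq)
      then have "generated_band (pprt (?f - of_rat p *\<^sub>R e)) \<le> bot" by (simp add: gt_lt_bot)
      then show "?f \<le> of_rat p *\<^sub>R e"
        by (simp add: generated_band_le_iff in_bot_band le_zero_iff_zero_pprt[symmetric])
    qed
    have "y = 0" if "y \<in> Rep_band ?b" for y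
      using nonneg[of "\<bar>y\<bar>"] band_solid[OF that, of "\<bar>y\<bar>"] by simp
    then show ?thesis
      by (intro antisym[OF _ bot_least]) (simp add: band_le_iff in_bot_band)
  qed
  show "h \<le> k"
  proof (rule cont_real_leI)
    fix p
    show "gt_val h p \<le> gt_val k p"
    proof (cases "p < 0")
      case True
      then show ?thesis using gt_val_mono[OF k0, of p] by (simp add: gt_val_zero top_unique)
    next
      case False
      have "inf (gt_val h q) top \<le> gt_val k p" if q: "p < q" for q
      \<comment> \<open>The midpoint lies strictly above p, as the covering relation requires, and
        strictly below q, as \<open>key\<close> requires.\<close>
      proof (rule frame_cover_sup[of "gt_val k p" "lt_val k ((p + q) / 2)"])
        show "sup (gt_val k p) (lt_val k ((p + q) / 2)) = top" using q by (intro gt_lt_top) simp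
        show "inf (inf (gt_val h q) top) (lt_val k ((p + q) / 2)) \<le> gt_val k p"
          using q False by (simp add: key)
      qed simp
      from gt_leI[of p h top, OF this] show ?thesis by simp
    qed
  qed
qed blast

end

theorem theorem7p4:
  fixes e :: "'a::archimedean_riesz_space"
  assumes "weak_unit e"
  shows "universal_completion (spectral_map e)"
  unfolding universal_completion_def
  using universally_complete_cont_real riesz_embedding_spectral_map[OF assms]
    isLub_spectral_map[OF assms] by blast

end
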